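(* Let $n\ge 3$, let $m\ge 0$ be an integer, let $f$ be a measurable function on $\mathbf{R}^{n-1}$ satisfying $$\int_{\mathbf{R}^{n-1}}\frac{|f(y')|}{1+|y'|^{n+m}}\,dy'<\infty ,$$ and let $\mu$ be a positive Borel measure on $H$ satisfying $$\int_H\frac{y_n}{1+|y|^{n+m}}\,d\mu(y)<\infty .$$ Let $u$ be the subharmonic function $$u(x)=v(x)+h(x),\qquad x\in H,$$ where $$v(x)=\int_{\mathbf{R}^{n-1}}P_m(x,y')f(y')\,dy',\qquad h(x)=\int_H G_m(x,y)\,d\mu(y).$$ Let $0<\alpha<2$. Then there exist a (finite or countably infinite) sequence of points $x_j\in H$ and radii $\rho_j>0$ such that $$\sum_{j}\frac{\rho_j^{\,n-\alpha}}{|x_j|^{\,n-\alpha}}<\infty$$ and, with $G=\bigcup_{j}B(x_j,\rho_j)$, $$u(x)=o\left(x_n^{1-\alpha}|x|^{m+\alpha}\right)\quad\text{as } |x|\to\infty,\ x\in H\setminus G .$$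
   Context: Points of $\mathbf{R}^n$ are written $x=(x',x_n)$ with $x'\in\mathbf{R}^{n-1}$, $x_n\in\mathbf{R}$; $|\cdot|$ is the Euclidean norm and $x\cdot y$ the Euclidean inner product. $H=\{x\in\mathbf{R}^n: x_n>0\}$ is the upper half space, and $\partial H$ is identified with $\mathbf{R}^{n-1}$ via $y'\mapsto(y',0)$. $B(x,\rho)$ is the open ball of centre $x$ and radius $\rho$ in $\mathbf{R}^n$. For $y=(y',y_n)$, $y^{\ast}=(y',-y_n)$ is its reflection in $\partial H$. $\omega_n=2\pi^{n/2}/\Gamma(n/2)$ is the surface area of the unit sphere in $\mathbf{R}^n$ and $r_n=\frac{1}{(n-2)\omega_n}$. For $\lambda>0$, the Gegenbauer (ultraspherical) polynomials $C_k^\lambda$ are defined by $(1-2tr+r^2)^{-\lambda}=\sum_{k=0}^\infty C_k^\lambda(t)r^k$ for $|r|<1$, $|t|\le1$. The Poisson kernel of $H$ is $P(x,y')=\dfrac{2x_n}{\omega_n|x-(y',0)|^n}$ for $x\in H$, $y'\in\mathbf{R}^{n-1}$. The modified Poisson kernel is $$P_m(x,y')=\begin{cases}P(x,y'), & |y'|\le 1,\\[4pt] P(x,y')-\displaystyle\sum_{k=0}^{m-1}\frac{2x_n|x|^k}{\omega_n|y'|^{n+k}}\,C_k^{n/2}\!\left(\frac{x\cdot(y',0)}{|x||y'|}\right), & |y'|>1,\end{cases}$$ where an empty sum is $0$. Let $E(x)=-r_n|x|^{2-n}$ for $x\ne0$, with $E(0)=-\infty$. For an integer $l\ge 0$ the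 modified function $E_l(x-y)$ (a function of the pair $(x,y)$) is $$E_l(x-y)=\begin{cases}E(x-y), & |y|\le1,\\[4pt] E(x-y)+\displaystyle\sum_{k=0}^{l-1}\frac{r_n|x|^k}{|y|^{n-2+k}}\,C_k^{\frac{n-2}{2}}\!\left(\frac{x\cdot y}{|x||y|}\right), & |y|>1,\end{cases}$$ and the modified Green function is $G_m(x,y)=E_{m+1}(x-y)-E_{m+1}(x-y^{\ast})$ for $x,y\in H$, where $E_{m+1}(x-y^\ast)$ is the same function evaluated at the pair $(x,y^\ast)$. Thus $h$ may take the value $-\infty$ at some points. *)

theory Defs
  imports "HOL-Analysis.Analysis" "HOL-Library.Landau_Symbols"
begin

text \<open>
  Points of $\mathbf{R}^n$ are pairs $(x', x_n)$ of type \<open>(real^'d) \<times> real\<close>, where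
  \<open>n = CARD('d) + 1\<close>; the norm and inner product of the product type are the Euclidean ones.
  The dimension is passed to the kernels as the explicit argument \<open>n\<close>.
\<close>

type_synonym 'd point = "(real ^ 'd) \<times> real"

definition half_space :: "'d::finite point set" where
  "half_space = {x. snd x > 0}"

definition reflect :: "'d::finite point \<Rightarrow> 'd point" where
  "reflect y = (fst y, - snd y)"

definition sphere_area :: "nat \<Rightarrow> real" where
  "sphere_area n = 2 * pi powr (real n / 2) / Gamma (real n / 2)"

definition riesz_const :: "nat \<Rightarrow> real" where
  "riesz_const n = 1 / ((real n - 2) * sphere_area n)"

text \<open>
  The values of the Gegenbauer polynomials on $[-1,1]$, given by their generating function;
  nothing is asserted about \<open>\<bar>t\<bar> > 1\<close>. Lemma \<open>gegenbauer_sums\<close> below shows that the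
  description is proper.
\<close>

definition gegenbauer :: "real \<Rightarrow> nat \<Rightarrow> real \<Rightarrow> real" where
  "gegenbauer l k t =
     (THE c. \<forall>r. \<bar>r\<bar> < 1 \<longrightarrow> (\<lambda>j. c j * r ^ j) sums ((1 - 2 * t * r + r\<^sup>2) powr (- l))) k"

lemma gegenbauer_unique:
  fixes c d :: "nat \<Rightarrow> real"
  assumes c: "\<And>r. \<bar>r\<bar> < 1 \<Longrightarrow> (\<lambda>j. c j * r ^ j) sums f r"
    and d: "\<And>r. \<bar>r\<bar> < 1 \<Longrightarrow> (\<lambda>j. d j * r ^ j) sums f r"
  shows "c = d"
proof (rule ccontr)
  assume "c \<noteq> d"
  define e where "e j = c j - d j" for j
  from \<open>c \<noteq> d\<close> have ex: "\<exists>n. e n \<noteq> 0" by (auto simp: e_def fun_eq_iff)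
  define n where "n = (LEAST n. e n \<noteq> 0)"
  have n: "e n \<noteq> 0" unfolding n_def using ex by (rule LeastI_ex)
  have lt: "e j = 0" if "j < n" for j
    using not_less_Least[of j "\<lambda>n. e n \<noteq> 0"] that by (auto simp: n_def)
  have "(\<lambda>j. e (j + n) * r ^ j) sums 0" if r: "r \<noteq> 0" "norm r < 1" for r
  proof -
    have "(\<lambda>j. e j * r ^ j) sums 0"
      using sums_diff[OF c[of r] d[of r]] r by (simp add: e_def left_diff_distrib)
    moreover have "(\<Sum>j<n. e j * r ^ j) = 0" using lt by simp
    ultimately have "(\<lambda>j. e (j + n) * r ^ (j + n)) sums 0"
      using sums_iff_shift'[of "\<lambda>j. e j * r ^ j" n 0] by simp
    from sums_mult_D[of "r ^ n" "\<lambda>j. e (j + n) * r ^ j" 0] this r show ?thesis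
      by (simp add: power_add algebra_simps)
  qed
  from powser_limit_0_strong[of 1 "\<lambda>j. e (j + n)" "\<lambda>_. 0", OF _ this]
  have "((\<lambda>_. 0) \<longlongrightarrow> e n) (at (0::real))" by simp
  hence "e n = 0" by (simp add: tendsto_const_iff)
  with n show False by simp
qed

lemma gegenbauer_exists:
  fixes t l :: real
  assumes t: "\<bar>t\<bar> \<le> 1"
  shows "\<exists>c. \<forall>r. \<bar>r\<bar> < 1 \<longrightarrow> (\<lambda>j. c j * r ^ j) sums ((1 - 2 * t * r + r\<^sup>2) powr (- l))"
proof -
  define w where "w = Complex t (sqrt (1 - t\<^sup>2))"
  have t2: "t\<^sup>2 \<le> 1" using t by (simp add: abs_square_le_1)
  have nw: "norm w = 1" using t2 by (simp add: w_def cmod_def)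
  define a where "a = (complex_of_real (- l))"
  define p where "p z i = (a gchoose i) * (- z) ^ i" for z and i :: nat
  define b where "b j = (\<Sum>i\<le>j. p w i * p (cnj w) (j - i))" for j
  have "(\<lambda>j. Re (b j) * r ^ j) sums ((1 - 2 * t * r + r\<^sup>2) powr (- l))" if r: "\<bar>r\<bar> < 1" for r
  proof -
    have s: "(\<lambda>i. p z i * of_real r ^ i) sums (1 - z * of_real r) powr a"
            "summable (\<lambda>i. norm (p z i * of_real r ^ i))" if z: "norm z = 1" for z
    proof -
      have lt: "norm (- z * of_real r) < 1" using z r by (simp add: norm_mult)
      have pe: "p z i * of_real r ^ i = (a gchoose i) * (- z * of_real r) ^ i" for i
        unfolding p_def power_mult_distrib by (simp only: mult.assoc)
      show "(\<lambda>i. p z i * of_real r ^ i) sums (1 - z * of_real r) powr a"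
        unfolding pe using gen_binomial_complex[OF lt, of a] by simp
      have "ereal (norm (- z * of_real r)) < conv_radius (\<lambda>i. a gchoose i)"
        using lt by (auto simp: conv_radius_gchoose)
      from abs_summable_in_conv_radius[OF this]
      show "summable (\<lambda>i. norm (p z i * of_real r ^ i))"
        unfolding pe .
    qed
    have nc: "norm (cnj w) = 1" using nw by simp
    have eq: "(\<Sum>i\<le>j. p w i * of_real r ^ i * (p (cnj w) (j - i) * of_real r ^ (j - i)))
               = b j * of_real r ^ j" for j
      unfolding b_def sum_distrib_right
    proof (intro sum.cong refl)
      fix i assume "i \<in> {..j}"
      hence "complex_of_real r ^ j = of_real r ^ i * of_real r ^ (j - i)"
        by (simp flip: power_add)
      thus "p w i * of_real r ^ i * (p (cnj w) (j - i) * of_real r ^ (j - i)) =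
              p w i * p (cnj w) (j - i) * of_real r ^ j"
        by (simp only: mult_ac)
    qed
    have S: "(\<lambda>j. b j * of_real r ^ j) sums
            ((1 - w * of_real r) powr a * (1 - cnj w * of_real r) powr a)"
      using Cauchy_product_sums[OF s(2)[OF nw] s(2)[OF nc]] s(1)[OF nw] s(1)[OF nc]
      by (simp add: eq sums_iff)
    define q where "q = 1 - w * of_real r"
    have q: "1 - cnj w * of_real r = cnj q" by (simp add: q_def)
    have "norm (w * of_real r) < 1" using nw r by (simp add: norm_mult)
    hence req: "Re q > 0"
      unfolding q_def using complex_Re_le_cmod[of "w * of_real r"] by simp
    hence q0: "q \<noteq> 0" and qn: "q \<notin> \<real>\<^sub>\<le>\<^sub>0" by (auto simp: complex_nonpos_Reals_iff)
    have "(norm q)\<^sup>2 = (1 - t * r)\<^sup>2 + (sqrt (1 - t\<^sup>2))\<^sup>2 * r\<^sup>2"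
      unfolding cmod_power2 by (simp add: q_def w_def power_mult_distrib)
    also have "\<dots> = (1 - t * r)\<^sup>2 + (1 - t\<^sup>2) * r\<^sup>2" using t2 by simp
    also have "\<dots> = 1 - 2 * t * r + r\<^sup>2" by (simp add: power2_eq_square algebra_simps)
    finally have nq: "(norm q)\<^sup>2 = 1 - 2 * t * r + r\<^sup>2" .
    have "q powr a * cnj q powr a = exp (a * (Ln q + cnj (Ln q)))"
      using q0 qn by (simp add: powr_def cnj_Ln exp_add distrib_left)
    also have "Ln q + cnj (Ln q) = of_real (2 * ln (norm q))"
      using q0 by (simp add: complex_add_cnj)
    also have "exp (a * of_real (2 * ln (norm q))) = of_real (exp (- l * (2 * ln (norm q))))"
      unfolding a_def of_real_mult[symmetric] exp_of_real by simp
    also have "exp (- l * (2 * ln (norm q))) = (1 - 2 * t * r + r\<^sup>2) powr (- l)"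
      unfolding nq[symmetric] using q0 by (simp add: powr_def ln_realpow)
    finally have "(\<lambda>j. b j * of_real r ^ j) sums of_real ((1 - 2 * t * r + r\<^sup>2) powr (- l))"
      using S unfolding q q_def[symmetric] by simp
    from sums_Re[OF this] show ?thesis
      unfolding of_real_power[symmetric] by (simp del: of_real_power)
  qed
  thus ?thesis by (intro exI[of _ "\<lambda>j. Re (b j)"] allI impI)
qed

lemma gegenbauer_sums:
  fixes t l r :: real
  assumes "\<bar>t\<bar> \<le> 1" "\<bar>r\<bar> < 1"
  shows "(\<lambda>k. gegenbauer l k t * r ^ k) sums ((1 - 2 * t * r + r\<^sup>2) powr (- l))"
proof -
  let ?P = "\<lambda>c. \<forall>r. \<bar>r\<bar> < 1 \<longrightarrow> (\<lambda>j. c j * r ^ j) sums ((1 - 2 * t * r + r\<^sup>2) powr (- l))"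
  obtain c where c: "?P c" using gegenbauer_exists[OF assms(1)] by blast
  have "?P (THE c. ?P c)"
  proof (rule theI[of ?P, OF c])
    fix d assume d: "?P d"
    show "d = c"
      by (rule gegenbauer_unique[of d "\<lambda>r. (1 - 2 * t * r + r\<^sup>2) powr (- l)" c]) (simp_all add: c d)
  qed
  thus ?thesis using assms(2) by (simp add: gegenbauer_def)
qed

definition poisson_kernel :: "nat \<Rightarrow> 'd::finite point \<Rightarrow> real ^ 'd \<Rightarrow> real" where
  "poisson_kernel n x y = 2 * snd x / (sphere_area n * norm (x - (y, 0)) ^ n)"

definition modified_poisson_kernel :: "nat \<Rightarrow> nat \<Rightarrow> 'd::finite point \<Rightarrow> real ^ 'd \<Rightarrow> real" where
  "modified_poisson_kernel n m x y =
     (if norm y \<le> 1 then poisson_kernel n x y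
      else poisson_kernel n x y -
        (\<Sum>k<m. 2 * snd x * norm x ^ k / (sphere_area n * norm y ^ (n + k)) *
                gegenbauer (real n / 2) k (x \<bullet> (y, 0) / (norm x * norm y))))"

definition fundamental_solution :: "nat \<Rightarrow> 'd::finite point \<Rightarrow> ereal" where
  "fundamental_solution n x =
     (if x = 0 then - \<infinity> else ereal (- riesz_const n * norm x powr (2 - real n)))"

text \<open>\<open>modified_fundamental_solution n l x y\<close> is $E_l(x-y)$, which depends on the pair $(x,y)$.\<close>

definition modified_fundamental_solution ::
    "nat \<Rightarrow> nat \<Rightarrow> 'd::finite point \<Rightarrow> 'd point \<Rightarrow> ereal" where
  "modified_fundamental_solution n l x y =
     (if norm y \<le> 1 then fundamental_solution n (x - y)
      else fundamental_solution n (x - y) + ereal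
        (\<Sum>k<l. riesz_const n * norm x ^ k / norm y ^ (n - 2 + k) *
                gegenbauer ((real n - 2) / 2) k (x \<bullet> y / (norm x * norm y))))"

definition modified_green :: "nat \<Rightarrow> nat \<Rightarrow> 'd::finite point \<Rightarrow> 'd point \<Rightarrow> ereal" where
  "modified_green n m x y =
     modified_fundamental_solution n (m + 1) x y -
     modified_fundamental_solution n (m + 1) x (reflect y)"

text \<open>
  Lebesgue integral of an extended-real function as positive part minus negative part
  (\<open>e2ennreal\<close> truncates at 0). It is meaningful if one of the two parts is finite; in the
  degenerate case HOL has \<open>\<infinity> - \<infinity> = \<infinity>\<close> in \<open>ereal\<close>.
\<close>

definition ereal_integral :: "'a measure \<Rightarrow> ('a \<Rightarrow> ereal) \<Rightarrow> ereal" where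
  "ereal_integral M g =
     enn2ereal (\<integral>\<^sup>+ y. e2ennreal (g y) \<partial>M) - enn2ereal (\<integral>\<^sup>+ y. e2ennreal (- g y) \<partial>M)"

definition poisson_integral :: "nat \<Rightarrow> nat \<Rightarrow> (real ^ 'd::finite \<Rightarrow> real) \<Rightarrow> 'd point \<Rightarrow> real" where
  "poisson_integral n m f x = (\<integral>y. modified_poisson_kernel n m x y * f y \<partial>lebesgue)"

definition green_potential ::
    "nat \<Rightarrow> nat \<Rightarrow> 'd::finite point measure \<Rightarrow> 'd point \<Rightarrow> ereal" where
  "green_potential n m \<mu> x = ereal_integral \<mu> (modified_green n m x)"

end

theory Submission
  imports Defs
begin

text \<open>
  Both parts of \<open>u\<close> are treated as potentials of finite measures. Dividing by $1+|y|^{n+m}$ makes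
  $|f(y')|\,dy'$, placed on the hyperplane $x_n = 0$, and $y_n\,d\mu(y)$ finite measures, and the
  kernels are multiplied by $1+|y|^{n+m}$ in return.

  The modification of the kernels removes the first terms of their expansions in powers of
  $|x|/|y|$, whose coefficients are Gegenbauer polynomials. As a cosine sum with nonnegative weights
  (\<open>gegenbauer_cos\<close>) such a polynomial and its Lipschitz constant are bounded by its value at 1 up to
  a factor $k^2$. Hence $|P_m|$ and $|G_m|/y_n$ satisfy the same estimates
  (\<open>modified_poisson_kernel_dominated\<close>, \<open>modified_green_dominated\<close>). After multiplication by
  $1+|y|^{n+m}$ they are at most a constant (\<open>dominated_kernel_bound\<close>) times the sum of $x_n|x|^m$ times
  $\min(1,(1+|y|)/|x|)$, whose integral tends to 0, and of $x_n|x|^{n+m}$ times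
  $|x-y|^{2-n}\max(x_n,|x-y|)^{-2}$ on the ball of radius $|x|/2$ about \<open>x\<close>.

  This last part is small if the mass of every ball about \<open>x\<close> of radius $r \le |x|/2$ is at most
  $\epsilon(r/|x|)^{n-\alpha}$: a sum over dyadic shells converges for the radii above $x_n$ because
  $\alpha > 0$ and for those below because $\alpha < 2$, and it gives $x_n^{1-\alpha}|x|^{m+\alpha}$
  times a multiple of $\epsilon$ (\<open>near_potential_bound\<close>). The points where some ball is too heavy
  are covered by Vitali's lemma: the selected balls are disjoint in each dyadic annulus, so the sum
  of $(r/|x|)^{n-\alpha}$ is at most a multiple of the total mass. Giving the measure a weight that tends to
  infinity beforehand lets \<open>\<epsilon>\<close> tend to 0 while the balls stay fixed (\<open>exceptional_balls\<close>).
\<close>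

section \<open>Bounds for Gegenbauer polynomials\<close>

text \<open>
  The Taylor coefficients of $(1-z)^{-l}$. Their positivity for $l > 0$ is what makes $t = 1$ the
  worst case in all bounds below.
\<close>

definition binomial_weight :: "real \<Rightarrow> nat \<Rightarrow> real" where
  "binomial_weight l i = pochhammer l i / fact i"

lemma binomial_weight_nonneg: "0 < l \<Longrightarrow> 0 \<le> binomial_weight l i"
  by (auto simp: binomial_weight_def intro!: divide_nonneg_pos pochhammer_nonneg)

lemma gchoose_uminus_eq_weight:
  "(complex_of_real (- l) gchoose i) * (- z) ^ i = of_real (binomial_weight l i) * z ^ i"
proof -
  have "((- 1 :: complex) ^ i) * (- z) ^ i = z ^ i"
    by (metis mult_minus1 power_mult_distrib minus_minus)
  thus ?thesis
    by (simp add: gbinomial_pochhammer binomial_weight_def pochhammer_of_real mult_ac)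
qed

text \<open>
  The generating function factors as
  $1 - 2r\cos\theta + r^2 = (1 - re^{i\theta})(1 - re^{-i\theta})$, so its power is the Cauchy product of
  two binomial series.
\<close>

lemma gegenbauer_cos:
  "gegenbauer l k (cos \<theta>) =
     (\<Sum>i\<le>k. binomial_weight l i * binomial_weight l (k - i) * cos ((2 * real i - real k) * \<theta>))"
proof -
  define b :: "nat \<Rightarrow> complex" where
    "b j = (\<Sum>i\<le>j. (of_real (binomial_weight l i) * cis \<theta> ^ i) *
                     (of_real (binomial_weight l (j - i)) * cis (- \<theta>) ^ (j - i)))" for j
  have Re_b: "Re (b j) = (\<Sum>i\<le>j. binomial_weight l i * binomial_weight l (j - i) *
      cos ((2 * real i - real j) * \<theta>))" for j
    unfolding b_def Re_sum
  proof (intro sum.cong refl)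
    fix i assume "i \<in> {..j}"
    hence angle: "real i * \<theta> + real (j - i) * (- \<theta>) = (2 * real i - real j) * \<theta>"
      by (simp add: of_nat_diff algebra_simps)
    have "cis \<theta> ^ i * cis (- \<theta>) ^ (j - i) = cis ((2 * real i - real j) * \<theta>)"
      by (simp only: Complex.DeMoivre cis_mult angle)
    hence e: "(of_real (binomial_weight l i) * cis \<theta> ^ i) *
        (of_real (binomial_weight l (j - i)) * cis (- \<theta>) ^ (j - i)) =
        of_real (binomial_weight l i * binomial_weight l (j - i)) *
        cis ((2 * real i - real j) * \<theta>)"
      by (metis (no_types, lifting) mult.assoc mult.left_commute of_real_mult)
    show "Re ((of_real (binomial_weight l i) * cis \<theta> ^ i) *
        (of_real (binomial_weight l (j - i)) * cis (- \<theta>) ^ (j - i))) =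
        binomial_weight l i * binomial_weight l (j - i) * cos ((2 * real i - real j) * \<theta>)"
      unfolding e by simp
  qed
  have main: "(\<lambda>j. Re (b j) * r ^ j) sums ((1 - 2 * cos \<theta> * r + r\<^sup>2) powr (- l))" if r: "\<bar>r\<bar> < 1" for r
  proof -
    let ?p = "\<lambda>z i. of_real (binomial_weight l i) * z ^ i * complex_of_real r ^ i"
    have s: "?p z sums (1 - z * of_real r) powr (of_real (- l))" "summable (\<lambda>i. norm (?p z i))"
      if z: "norm z = 1" for z
    proof -
      have lt: "norm (- (z * of_real r)) < 1" using z r by (simp add: norm_mult)
      have pe: "(complex_of_real (- l) gchoose i) * (- (z * of_real r)) ^ i = ?p z i" for i
        by (simp only: gchoose_uminus_eq_weight power_mult_distrib mult.assoc)
      show "?p z sums (1 - z * of_real r) powr (of_real (- l))"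
        using gen_binomial_complex[OF lt, of "of_real (- l)"] unfolding pe by simp
      have "ereal (norm (- (z * of_real r))) < conv_radius (\<lambda>i. complex_of_real (- l) gchoose i)"
        using lt by (auto simp: conv_radius_gchoose)
      from abs_summable_in_conv_radius[OF this] show "summable (\<lambda>i. norm (?p z i))"
        unfolding pe .
    qed
    define q where "q = 1 - cis \<theta> * of_real r"
    have q: "1 - cis (- \<theta>) * of_real r = cnj q" by (simp add: q_def cis_cnj)
    have "Re (cis \<theta> * of_real r) < 1"
      using complex_Re_le_cmod[of "cis \<theta> * of_real r"] r by (simp add: norm_mult)
    hence "Re q > 0" unfolding q_def by simp
    hence q0: "q \<noteq> 0" and qn: "q \<notin> \<real>\<^sub>\<le>\<^sub>0" by (auto simp: complex_nonpos_Reals_iff)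
    have "(norm q)\<^sup>2 = (1 - cos \<theta> * r)\<^sup>2 + (sin \<theta> * r)\<^sup>2"
      unfolding cmod_power2 by (simp add: q_def)
    also have "\<dots> = 1 - 2 * cos \<theta> * r + ((sin \<theta>)\<^sup>2 + (cos \<theta>)\<^sup>2) * r\<^sup>2"
      by algebra
    finally have nq: "(norm q)\<^sup>2 = 1 - 2 * cos \<theta> * r + r\<^sup>2" by simp
    have "q powr a * cnj q powr a = exp (a * (Ln q + cnj (Ln q)))" for a
      using q0 qn by (simp add: powr_def cnj_Ln exp_add distrib_left)
    hence "q powr of_real (- l) * cnj q powr of_real (- l) = exp (of_real (- l) * (Ln q + cnj (Ln q)))" .
    also have "Ln q + cnj (Ln q) = of_real (2 * ln (norm q))"
      using q0 by (simp add: complex_add_cnj)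
    also have "exp (of_real (- l) * complex_of_real (2 * ln (norm q))) =
        of_real (exp (- l * (2 * ln (norm q))))"
      unfolding of_real_mult[symmetric] exp_of_real by simp
    also have "exp (- l * (2 * ln (norm q))) = (1 - 2 * cos \<theta> * r + r\<^sup>2) powr (- l)"
      unfolding nq[symmetric] using q0 by (simp add: powr_def ln_realpow)
    finally have prod: "q powr of_real (- l) * cnj q powr of_real (- l) =
        of_real ((1 - 2 * cos \<theta> * r + r\<^sup>2) powr (- l))" .
    have eq: "(\<Sum>i\<le>j. ?p (cis \<theta>) i * ?p (cis (- \<theta>)) (j - i)) = b j * of_real (r ^ j)" for j
      unfolding b_def sum_distrib_right
    proof (intro sum.cong refl)
      fix i assume "i \<in> {..j}"
      hence "complex_of_real (r ^ j) = of_real r ^ i * of_real r ^ (j - i)"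
        by (simp flip: power_add)
      thus "?p (cis \<theta>) i * ?p (cis (- \<theta>)) (j - i) = (of_real (binomial_weight l i) * cis \<theta> ^ i) *
          (of_real (binomial_weight l (j - i)) * cis (- \<theta>) ^ (j - i)) * of_real (r ^ j)"
        by (simp only: mult_ac)
    qed
    have n1: "norm (cis \<theta>) = 1" "norm (cis (- \<theta>)) = 1" by simp_all
    have "(\<lambda>j. b j * of_real (r ^ j)) sums of_real ((1 - 2 * cos \<theta> * r + r\<^sup>2) powr (- l))"
      using Cauchy_product_sums[OF s(2)[OF n1(1)] s(2)[OF n1(2)]] s(1)[OF n1(1)] s(1)[OF n1(2)]
      unfolding eq q[unfolded q_def] q_def[symmetric] q prod[symmetric] by (simp add: sums_iff q_def q)
    from sums_Re[OF this] show ?thesis by (simp del: of_real_power)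
  qed
  have "(\<lambda>k. gegenbauer l k (cos \<theta>)) = (\<lambda>k. Re (b k))"
    by (rule gegenbauer_unique[OF gegenbauer_sums main]) simp_all
  thus ?thesis by (metis Re_b)
qed

lemma abs_sin_of_nat_mult_le: "\<bar>sin (real k * x)\<bar> \<le> real k * \<bar>sin x\<bar>"
proof (induction k)
  case (Suc k)
  have "sin (real (Suc k) * x) = sin (real k * x) * cos x + cos (real k * x) * sin x"
    by (simp add: distrib_right sin_add add.commute)
  also have "\<bar>\<dots>\<bar> \<le> \<bar>sin (real k * x)\<bar> * \<bar>cos x\<bar> + \<bar>cos (real k * x)\<bar> * \<bar>sin x\<bar>"
    by (metis abs_mult abs_triangle_ineq)
  also have "\<dots> \<le> \<bar>sin (real k * x)\<bar> * 1 + 1 * \<bar>sin x\<bar>"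
    by (intro add_mono mult_left_mono mult_right_mono) auto
  finally show ?case using Suc by (simp add: algebra_simps)
qed simp

text \<open>
  The difference of cosines is a product of sines, and $|\sin kx| \le k|\sin x|$.
\<close>

lemma abs_cos_of_nat_mult_diff_le:
  "\<bar>cos (real k * a) - cos (real k * b)\<bar> \<le> (real k)\<^sup>2 * \<bar>cos a - cos b\<bar>"
proof -
  have "\<bar>cos (real k * a) - cos (real k * b)\<bar> =
      2 * (\<bar>sin (real k * ((a + b) / 2))\<bar> * \<bar>sin (real k * ((b - a) / 2))\<bar>)"
    by (subst cos_diff_cos) (simp add: abs_mult algebra_simps)
  also have "\<dots> \<le> 2 * ((real k * \<bar>sin ((a + b) / 2)\<bar>) * (real k * \<bar>sin ((b - a) / 2)\<bar>))"
    by (intro mult_left_mono mult_mono abs_sin_of_nat_mult_le) auto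
  also have "\<dots> = (real k)\<^sup>2 * \<bar>cos a - cos b\<bar>"
    unfolding cos_diff_cos[of a b] by (simp add: abs_mult power2_eq_square)
  finally show ?thesis .
qed

lemma gegenbauer_one:
  "gegenbauer l k 1 = (\<Sum>i\<le>k. binomial_weight l i * binomial_weight l (k - i))"
  using gegenbauer_cos[of l k 0] by simp

lemma gegenbauer_one_nonneg: "0 < l \<Longrightarrow> 0 \<le> gegenbauer l k 1"
  unfolding gegenbauer_one by (intro sum_nonneg mult_nonneg_nonneg binomial_weight_nonneg)

lemma abs_gegenbauer_le:
  assumes "0 < l" "\<bar>t\<bar> \<le> 1"
  shows "\<bar>gegenbauer l k t\<bar> \<le> gegenbauer l k 1"
proof -
  have "t = cos (arccos t)" using assms by (simp add: abs_le_iff)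
  hence "\<bar>gegenbauer l k t\<bar> = \<bar>gegenbauer l k (cos (arccos t))\<bar>" by simp
  also have "\<dots> \<le> (\<Sum>i\<le>k. \<bar>binomial_weight l i * binomial_weight l (k - i) *
      cos ((2 * real i - real k) * arccos t)\<bar>)"
    unfolding gegenbauer_cos by (rule sum_abs)
  also have "\<dots> \<le> gegenbauer l k 1"
    unfolding gegenbauer_one abs_mult
    using binomial_weight_nonneg[OF assms(1)] by (intro sum_mono) (simp add: mult_left_le)
  finally show ?thesis .
qed

text \<open>
  The modified Green function contains differences of Gegenbauer polynomials at the cosines
  belonging to \<open>y\<close> and to its reflection. These cosines differ by $2x_ny_n/(|x||y|)$, so a Lipschitz
  bound produces the factor $y_n$ which the integrability of \<open>\<mu>\<close> requires. The square comes from the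
  cosine sum, whose frequencies are at most \<open>k\<close>.
\<close>

lemma gegenbauer_lipschitz:
  assumes "0 < l" "\<bar>t\<bar> \<le> 1" "\<bar>s\<bar> \<le> 1"
  shows "\<bar>gegenbauer l k t - gegenbauer l k s\<bar> \<le> (real k)\<^sup>2 * gegenbauer l k 1 * \<bar>t - s\<bar>"
proof -
  define a b where "a = arccos t" and "b = arccos s"
  have ab: "t = cos a" "s = cos b" using assms by (auto simp: a_def b_def abs_le_iff)
  let ?w = "\<lambda>i. binomial_weight l i * binomial_weight l (k - i)"
  let ?c = "\<lambda>i x. cos ((2 * real i - real k) * x)"
  have w: "0 \<le> ?w i" for i
    using binomial_weight_nonneg[OF assms(1)] by simp
  have c: "\<bar>?c i a - ?c i b\<bar> \<le> (real k)\<^sup>2 * \<bar>t - s\<bar>" if "i \<le> k" for i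
  proof -
    define j where "j = (if 2 * i \<le> k then k - 2 * i else 2 * i - k)"
    have "?c i x = cos (real j * x)" for x
    proof (cases "2 * i \<le> k")
      case True
      hence "(2 * real i - real k) * x = - (real j * x)" by (simp add: j_def of_nat_diff algebra_simps)
      thus ?thesis by (metis cos_minus)
    qed (simp add: j_def of_nat_diff)
    hence "\<bar>?c i a - ?c i b\<bar> \<le> (real j)\<^sup>2 * \<bar>t - s\<bar>"
      using abs_cos_of_nat_mult_diff_le[of j a b] ab by simp
    also have "\<dots> \<le> (real k)\<^sup>2 * \<bar>t - s\<bar>"
      using that by (intro mult_right_mono power_mono) (auto simp: j_def)
    finally show ?thesis .
  qed
  have "\<bar>gegenbauer l k t - gegenbauer l k s\<bar> = \<bar>\<Sum>i\<le>k. ?w i * (?c i a - ?c i b)\<bar>"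
    unfolding ab gegenbauer_cos by (simp add: sum_subtractf right_diff_distrib)
  also have "\<dots> \<le> (\<Sum>i\<le>k. \<bar>?w i * (?c i a - ?c i b)\<bar>)" by (rule sum_abs)
  also have "\<dots> \<le> (\<Sum>i\<le>k. ?w i * ((real k)\<^sup>2 * \<bar>t - s\<bar>))"
    unfolding abs_mult[of "?w _"] using w c by (intro sum_mono mult_mono) (auto simp del: abs_mult)
  also have "\<dots> = (real k)\<^sup>2 * gegenbauer l k 1 * \<bar>t - s\<bar>"
    unfolding gegenbauer_one sum_distrib_left sum_distrib_right by (simp add: mult_ac)
  finally show ?thesis .
qed

lemma summable_gegenbauer_one: "summable (\<lambda>k. gegenbauer l k 1 * (1/2) ^ k)"
  using gegenbauer_sums[of 1 "1/2" l] by (simp add: sums_iff)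

lemma summable_sq_gegenbauer_one:
  assumes "0 < l"
  shows "summable (\<lambda>k. (real k)\<^sup>2 * gegenbauer l k 1 * (1/2) ^ k)"
proof -
  \<comment> \<open>\<open>1/2 = (5/6)\<^sup>2 * (18/25)\<close>: the first factor absorbs \<open>k\<^sup>2\<close>, and the series still converges at \<open>18/25\<close>.\<close>
  have "(\<lambda>k. real k * (5/6) ^ k) \<longlonglongrightarrow> 0"
    using powser_times_n_limit_0[of "5/6 :: real"] by simp
  hence "Bseq (\<lambda>k. real k * (5/6) ^ k)"
    by (intro convergent_imp_Bseq convergentI)
  then obtain D where D: "\<And>k. norm (real k * (5/6) ^ k) \<le> D"
    by (elim BseqE) metis
  have sq: "(real k)\<^sup>2 * (25/36) ^ k \<le> D\<^sup>2" for k
  proof -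
    have "(real k * (5/6) ^ k)\<^sup>2 \<le> D\<^sup>2"
      using D[of k] by (intro power_mono) auto
    also have "(real k * (5/6) ^ k)\<^sup>2 = (real k)\<^sup>2 * (25/36) ^ k"
      unfolding power_mult_distrib power_even_eq[symmetric] power_mult by (simp add: power2_eq_square)
    finally show ?thesis .
  qed
  have "summable (\<lambda>k. D\<^sup>2 * (gegenbauer l k 1 * (18/25) ^ k))"
    using gegenbauer_sums[of 1 "18/25" l] by (intro summable_mult) (simp add: sums_iff)
  thus ?thesis
  proof (rule summable_comparison_test'[where N=0])
    fix k
    have "(1/2 :: real) ^ k = (25/36) ^ k * (18/25) ^ k"
      unfolding power_mult_distrib[symmetric] by simp
    hence "norm ((real k)\<^sup>2 * gegenbauer l k 1 * (1/2) ^ k) =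
        ((real k)\<^sup>2 * (25/36) ^ k) * (gegenbauer l k 1 * (18/25) ^ k)"
      using gegenbauer_one_nonneg[OF assms, of k] by (simp add: abs_mult)
    also have "\<dots> \<le> D\<^sup>2 * (gegenbauer l k 1 * (18/25) ^ k)"
      using gegenbauer_one_nonneg[OF assms] sq by (intro mult_right_mono) auto
    finally show "norm ((real k)\<^sup>2 * gegenbauer l k 1 * (1/2) ^ k) \<le>
        D\<^sup>2 * (gegenbauer l k 1 * (18/25) ^ k)" .
  qed
qed

section \<open>Bounds for the modified kernels\<close>

text \<open>
  The common size of $P(x,y)/x_n$ for a boundary point \<open>y\<close>, where $|x-y| \ge x_n$ makes this
  $|x-y|^{-n}$, and of $|G(x,y)|/(x_ny_n)$ for \<open>y\<close> in the half space, where
  $|x-y^*| \ge \max(x_n,|x-y|)$.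
\<close>

definition riesz_majorant :: "nat \<Rightarrow> 'd::finite point \<Rightarrow> 'd point \<Rightarrow> real" where
  "riesz_majorant n x y = 1 / (norm (x - y) ^ (n - 2) * (max (snd x) (norm (x - y)))\<^sup>2)"

text \<open>
  What $K = |P_m(x,y)|$ and $K = |G_m(x,y)|/y_n$ have in common: a singular part, the polynomial
  corrections of degree below \<open>m\<close> for $|y| > 1$, and the decay of order \<open>m\<close> that the corrections
  bring about when \<open>y\<close> is far out.
\<close>

definition dominated_kernel ::
  "nat \<Rightarrow> nat \<Rightarrow> real \<Rightarrow> 'd::finite point \<Rightarrow> 'd point \<Rightarrow> real \<Rightarrow> bool" where
  "dominated_kernel n m C x y K \<longleftrightarrow>
     K \<le> C * snd x * (riesz_majorant n x y +
       (if norm y \<le> 1 then 0 else \<Sum>k<m. norm x ^ k / norm y ^ (n + k))) \<and>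
     (1 < norm y \<and> 2 * norm x \<le> norm y \<longrightarrow> K \<le> C * snd x * (norm x ^ m / norm y ^ (n + m)))"

text \<open>
  A dominated kernel multiplied by $1+|y|^{n+m}$ and divided by $x_n$ has this size. The first
  summand is $|x|^m$ times a bounded factor that vanishes as $|x| \to \infty$ for fixed \<open>y\<close>; only the
  second one, the singularity at \<open>x\<close>, needs exceptional balls.
\<close>

definition potential_majorant :: "nat \<Rightarrow> nat \<Rightarrow> 'd::finite point \<Rightarrow> 'd point \<Rightarrow> real" where
  "potential_majorant n m x y = norm x ^ m * min 1 ((1 + norm y) / norm x) +
     norm x ^ (n + m) * riesz_majorant n x y * indicator (ball x (norm x / 2)) y"

lemma riesz_majorant_nonneg: "0 \<le> riesz_majorant n x y"
  by (simp add: riesz_majorant_def)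

lemma power_diff_two_mult: "2 \<le> n \<Longrightarrow> a ^ (n - 2) * a\<^sup>2 = a ^ n" for a :: real
  by (metis le_add_diff_inverse2 power_add)

lemma riesz_majorant_far:
  assumes "2 \<le> n" "0 < norm x" "norm x / 2 \<le> norm (x - y)"
  shows "riesz_majorant n x y \<le> 2 ^ n / norm x ^ n"
proof -
  have "(norm x / 2) ^ n = (norm x / 2) ^ (n - 2) * (norm x / 2)\<^sup>2"
    by (simp only: power_diff_two_mult[OF assms(1)])
  also have "\<dots> \<le> norm (x - y) ^ (n - 2) * (max (snd x) (norm (x - y)))\<^sup>2"
    using assms by (intro mult_mono power_mono) auto
  finally have le: "(norm x / 2) ^ n \<le> norm (x - y) ^ (n - 2) * (max (snd x) (norm (x - y)))\<^sup>2" .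
  moreover have "0 < (norm x / 2) ^ n" using assms by simp
  ultimately have "riesz_majorant n x y \<le> 1 / (norm x / 2) ^ n"
    unfolding riesz_majorant_def by (intro frac_le) auto
  thus ?thesis by (simp add: power_divide)
qed

lemma power_le_min_one:
  fixes q :: real
  assumes "0 \<le> q" "q \<le> 3" "0 < j"
  shows "q ^ j \<le> 3 ^ j * min 1 q"
proof (cases "q \<le> 1")
  case True
  have "q ^ j \<le> q ^ 1" using True assms by (intro power_decreasing) auto
  also have "\<dots> \<le> 3 ^ j * q" using assms by (simp add: mult_ge1_I mult_right_mono[of 1 "3 ^ j" q, simplified])
  finally show ?thesis using True by simp
next
  case False
  thus ?thesis using assms by (simp add: power_mono)
qed

text \<open>
  For $|y| \ge 2|x|$ the decay of order \<open>m\<close> gives $|x|^m$ at once. For smaller \<open>y\<close> the corrections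
  become $|x|^k|y|^{m-k} = |x|^m(|y|/|x|)^{m-k}$, and the exponent $m-k$ is positive, which leaves at
  least one factor $|y|/|x|$. The singular part is $|x|^{-n}$ off the ball about \<open>x\<close> of radius
  $|x|/2$ and is kept as it stands inside it.
\<close>

lemma dominated_kernel_bound:
  fixes x y :: "'d::finite point"
  assumes K: "dominated_kernel n m C x y K" and n: "2 \<le> n" and C: "0 \<le> C"
    and x: "0 < snd x" "2 \<le> norm x"
  shows "K * (1 + norm y ^ (n + m)) \<le>
    C * (2 * 6 ^ (n + m) + 2 * real m * 3 ^ m) * snd x * potential_majorant n m x y"
proof -
  define s Y R g where "s = norm x" and "Y = norm y" and "R = riesz_majorant n x y"
    and "g = min 1 ((1 + Y) / s)"
  define near :: real where "near = indicator (ball x (s / 2)) y"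
  have s: "2 \<le> s" and Y: "0 \<le> Y" and R: "0 \<le> R" and g: "0 \<le> g" and near: "0 \<le> near"
    using x by (auto simp: s_def Y_def R_def g_def near_def riesz_majorant_nonneg)
  have W: "potential_majorant n m x y = s ^ m * g + s ^ (n + m) * R * near"
    by (simp add: potential_majorant_def s_def Y_def R_def g_def near_def)
  let ?A = "2 * 6 ^ (n + m) :: real" and ?B = "2 * real m * 3 ^ m :: real"
  have CX: "0 \<le> C * snd x" using C x by simp
  have main: "K * (1 + Y ^ (n + m)) \<le> C * snd x * ((?A + ?B) * (s ^ m * g + s ^ (n + m) * R * near))"
  proof (cases "1 < Y \<and> 2 * s \<le> Y")
    case True
    have "K \<le> C * snd x * (s ^ m / Y ^ (n + m))"
      using K True unfolding dominated_kernel_def s_def Y_def by blast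
    hence "K * (1 + Y ^ (n + m)) \<le> C * snd x * (s ^ m / Y ^ (n + m)) * (1 + Y ^ (n + m))"
      using Y by (intro mult_right_mono) auto
    also have "\<dots> \<le> C * snd x * (s ^ m / Y ^ (n + m)) * (2 * Y ^ (n + m))"
      using True s CX by (intro mult_left_mono) auto
    also have "\<dots> = C * snd x * (2 * (s ^ m * 1))" using True by simp
    also have "\<dots> \<le> C * snd x * ((?A + ?B) * (s ^ m * g + s ^ (n + m) * R * near))"
    proof (intro mult_left_mono[OF _ CX] mult_mono)
      have "(1::real) \<le> 6 ^ (n + m)" by simp
      thus "2 \<le> ?A + ?B" by (intro order_trans[OF _ add_increasing2]) auto
      \<comment> \<open>as \<open>\<bar>y\<bar> \<ge> \<bar>x\<bar>\<close>, the minimum defining the far factor is 1\<close>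
      have "g = 1" using True s by (simp add: g_def)
      thus "s ^ m * 1 \<le> s ^ m * g + s ^ (n + m) * R * near" using s R near by simp
    qed (use s in auto)
    finally show ?thesis .
  next
    case False
    hence Y2: "Y < 2 * s" using s by linarith
    define q where "q = (1 + Y) / s"
    have q: "0 \<le> q" "q \<le> 3" "Y / s \<le> q" "1 + Y = s * q" "g = min 1 q"
      using Y s Y2 by (auto simp: q_def divide_simps g_def)
    have R_part: "R * (1 + Y ^ (n + m)) \<le> ?A * (s ^ m * g + s ^ (n + m) * R * near)"
    proof (cases "y \<in> ball x (s / 2)")
      case True
      have "1 + Y ^ (n + m) \<le> (6 * s) ^ (n + m) + (6 * s) ^ (n + m)"
        using s Y Y2 by (intro add_mono power_mono one_le_power) auto
      hence "R * (1 + Y ^ (n + m)) \<le> R * (2 * (6 * s) ^ (n + m))"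
        by (intro mult_left_mono R) linarith
      also have "\<dots> = ?A * (s ^ (n + m) * R * near)"
        using True by (simp add: near_def power_mult_distrib)
      also have "\<dots> \<le> ?A * (s ^ m * g + s ^ (n + m) * R * near)"
        using s g by (intro mult_left_mono) auto
      finally show ?thesis .
    next
      case False
      hence "s / 2 \<le> norm (x - y)" by (simp add: dist_norm)
      hence "R \<le> 2 ^ n / s ^ n"
        unfolding R_def s_def using n x by (intro riesz_majorant_far) auto
      moreover have "1 + Y ^ (n + m) \<le> 2 * s ^ (n + m) * (3 ^ (n + m) * g)"
      proof -
        have "1 + Y ^ (n + m) \<le> (1 + Y) ^ (n + m) + (1 + Y) ^ (n + m)"
          using Y by (intro add_mono power_mono one_le_power) auto
        also have "\<dots> = 2 * s ^ (n + m) * q ^ (n + m)" by (simp add: q power_mult_distrib)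
        also have "\<dots> \<le> 2 * s ^ (n + m) * (3 ^ (n + m) * g)"
          unfolding q(5) using q n s by (intro mult_left_mono power_le_min_one) auto
        finally show ?thesis .
      qed
      ultimately have "R * (1 + Y ^ (n + m)) \<le>
          2 ^ n / s ^ n * (2 * s ^ (n + m) * (3 ^ (n + m) * g))"
        using Y s by (intro mult_mono) auto
      also have "\<dots> = 2 ^ n * 3 ^ (n + m) * (2 * (s ^ m * g))"
        using s by (simp add: power_add field_simps)
      also have "\<dots> \<le> 2 ^ (n + m) * 3 ^ (n + m) * (2 * (s ^ m * g))"
        using s g by (intro mult_right_mono power_increasing) auto
      also have "\<dots> = ?A * (s ^ m * g)" by (simp flip: power_mult_distrib)
      also have "\<dots> \<le> ?A * (s ^ m * g + s ^ (n + m) * R * near)"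
        using s R near by (intro mult_left_mono) auto
      finally show ?thesis .
    qed
    define S where "S = (if Y \<le> 1 then 0 else \<Sum>k<m. s ^ k / Y ^ (n + k))"
    have S_part: "S * (1 + Y ^ (n + m)) \<le> ?B * (s ^ m * g + s ^ (n + m) * R * near)"
    proof (cases "Y \<le> 1")
      case True
      thus ?thesis using s R g near by (simp add: S_def)
    next
      case False
      have "S * (1 + Y ^ (n + m)) = (\<Sum>k<m. s ^ k / Y ^ (n + k) * (1 + Y ^ (n + m)))"
        using False by (simp add: S_def sum_distrib_right)
      also have "\<dots> \<le> (\<Sum>k<m. 2 * 3 ^ m * (s ^ m * g))"
      proof (intro sum_mono)
        fix k assume "k \<in> {..<m}"
        hence k: "k < m" "n + m = (n + k) + (m - k)" "m = k + (m - k)" by auto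
        have "s ^ k / Y ^ (n + k) * (1 + Y ^ (n + m)) \<le> s ^ k / Y ^ (n + k) * (2 * Y ^ (n + m))"
          using False s by (intro mult_left_mono) auto
        also have "\<dots> = 2 * (s ^ k * s ^ (m - k)) * (Y / s) ^ (m - k)"
          using False s by (subst k(2), subst power_add) (simp add: power_divide)
        also have "\<dots> = 2 * s ^ m * (Y / s) ^ (m - k)"
          using k(3) by (simp flip: power_add)
        also have "\<dots> \<le> 2 * s ^ m * (3 ^ (m - k) * min 1 q)"
          using q s Y k by (intro mult_left_mono order_trans[OF power_mono power_le_min_one]) auto
        also have "\<dots> \<le> 2 * s ^ m * (3 ^ m * min 1 q)"
          using q s by (intro mult_left_mono mult_right_mono power_increasing) auto
        finally show "s ^ k / Y ^ (n + k) * (1 + Y ^ (n + m)) \<le> 2 * 3 ^ m * (s ^ m * g)"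
          by (simp add: q mult_ac)
      qed
      also have "\<dots> = ?B * (s ^ m * g)" by simp
      also have "\<dots> \<le> ?B * (s ^ m * g + s ^ (n + m) * R * near)"
        using s R near by (intro mult_left_mono) auto
      finally show ?thesis .
    qed
    have "K \<le> C * snd x * (R + S)"
      using K unfolding dominated_kernel_def s_def Y_def R_def S_def by blast
    hence "K * (1 + Y ^ (n + m)) \<le> C * snd x * (R + S) * (1 + Y ^ (n + m))"
      using Y by (intro mult_right_mono) auto
    also have "\<dots> = C * snd x * (R * (1 + Y ^ (n + m)) + S * (1 + Y ^ (n + m)))"
      by (simp add: algebra_simps)
    also have "\<dots> \<le> C * snd x * (?A * (s ^ m * g + s ^ (n + m) * R * near) +
        ?B * (s ^ m * g + s ^ (n + m) * R * near))"
      by (intro mult_left_mono[OF _ CX] add_mono R_part S_part)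
    finally show ?thesis by (simp only: distrib_right)
  qed
  thus ?thesis unfolding W Y_def by (simp only: mult_ac)
qed

text \<open>
  Subtracting the first \<open>l\<close> terms leaves a remainder of order $r^l$, uniformly for $r \le 1/2$ and in
  proportion to a common factor \<open>d\<close> of the coefficients.
\<close>

lemma power_series_tail:
  fixes a c :: "nat \<Rightarrow> real"
  assumes F: "(\<lambda>k. c k * r ^ k) sums F" and a: "summable (\<lambda>k. a k * (1/2) ^ k)"
    and c: "\<And>k. \<bar>c k\<bar> \<le> a k * d" and a0: "\<And>k. 0 \<le> a k" and d: "0 \<le> d"
    and r: "0 \<le> r" "r \<le> 1/2"
  shows "\<bar>F - (\<Sum>k<l. c k * r ^ k)\<bar> \<le> d * r ^ l * 2 ^ l * (\<Sum>k. a k * (1/2) ^ k)"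
proof -
  let ?b = "\<lambda>k. d * r ^ l * 2 ^ l * (a (k + l) * (1/2) ^ (k + l))"
  have tail: "(\<lambda>k. c (k + l) * r ^ (k + l)) sums (F - (\<Sum>k<l. c k * r ^ k))"
    using F by (rule sums_split_initial_segment)
  have b: "summable ?b"
    using a by (intro summable_mult) (subst summable_iff_shift)
  have le: "norm (c (k + l) * r ^ (k + l)) \<le> ?b k" for k
  proof -
    have "norm (c (k + l) * r ^ (k + l)) = \<bar>c (k + l)\<bar> * (r ^ k * r ^ l)"
      using r by (simp add: abs_mult power_add)
    also have "\<dots> \<le> (a (k + l) * d) * ((1/2) ^ k * r ^ l)"
      using r a0 d by (intro mult_mono c power_mono) auto
    also have "\<dots> = ?b k" by (simp add: power_add power_divide)
    finally show ?thesis .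
  qed
  have "\<bar>F - (\<Sum>k<l. c k * r ^ k)\<bar> = norm (\<Sum>k. c (k + l) * r ^ (k + l))"
    using tail by (simp add: sums_iff)
  also have "\<dots> \<le> (\<Sum>k. ?b k)"
    using le b by (rule norm_suminf_le)
  also have "\<dots> = d * r ^ l * 2 ^ l * (\<Sum>k. a (k + l) * (1/2) ^ (k + l))"
    using a by (intro suminf_mult) (subst summable_iff_shift)
  also have "\<dots> \<le> d * r ^ l * 2 ^ l * (\<Sum>k. a k * (1/2) ^ k)"
    using a0 d r suminf_split_initial_segment[OF a, of l]
    by (intro mult_left_mono) (auto intro!: sum_nonneg)
  finally show ?thesis .
qed

text \<open>
  By the law of cosines the base of the power is $(|x-y|/|y|)^2$.
\<close>

lemma gegenbauer_generating_norm:
  fixes x y :: "'a::real_inner"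
  assumes "x \<noteq> 0" "y \<noteq> 0" "x \<noteq> y"
  shows "(1 - 2 * (x \<bullet> y / (norm x * norm y)) * (norm x / norm y) + (norm x / norm y)\<^sup>2) powr (- (real N / 2))
    = norm y ^ N / norm (x - y) ^ N"
proof -
  define z where "z = norm (x - y) / norm y"
  have z: "0 < z" using assms by (simp add: z_def)
  have "z\<^sup>2 = ((norm x)\<^sup>2 - 2 * (x \<bullet> y) + (norm y)\<^sup>2) / (norm y)\<^sup>2"
    unfolding z_def power_divide
    by (simp add: power2_norm_eq_inner inner_diff_left inner_diff_right inner_commute)
  also have "\<dots> = 1 - 2 * (x \<bullet> y / (norm x * norm y)) * (norm x / norm y) + (norm x / norm y)\<^sup>2"
    using assms by (simp add: field_simps power2_eq_square)
  finally have "(1 - 2 * (x \<bullet> y / (norm x * norm y)) * (norm x / norm y) + (norm x / norm y)\<^sup>2) powr (- (real N / 2))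
      = (z powr 2) powr (- (real N / 2))"
    using z by simp
  also have "\<dots> = z powr (- real N)" by (simp add: powr_powr del: powr_numeral)
  also have "\<dots> = 1 / z ^ N" using z by (simp add: powr_minus_divide powr_realpow)
  finally show ?thesis by (simp add: z_def power_divide)
qed

lemma abs_cosine_le_1:
  fixes x y :: "'a::real_inner"
  shows "\<bar>x \<bullet> y / (norm x * norm y)\<bar> \<le> 1"
proof (cases "norm x * norm y = 0")
  case False
  hence "0 < norm x * norm y" by simp
  thus ?thesis using Cauchy_Schwarz_ineq2[of x y] by (simp add: abs_div_pos[symmetric])
qed auto

lemma sphere_area_pos: "0 < n \<Longrightarrow> 0 < sphere_area n"
  by (simp add: sphere_area_def Gamma_real_pos)

lemma riesz_const_pos: "3 \<le> n \<Longrightarrow> 0 < riesz_const n"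
  by (simp add: riesz_const_def sphere_area_pos)

lemma snd_le_norm: "snd x \<le> norm x" for x :: "'a::real_normed_vector \<times> real"
  using norm_snd_le[of "snd x" "fst x"] by simp

text \<open>
  The sum subtracted from the Poisson kernel is an initial segment of its expansion in powers of
  $|x|/|y|$, so for $|y| \ge 2|x|$ only the tail of that series remains.
\<close>

lemma modified_poisson_kernel_dominated:
  assumes n: "2 \<le> n"
  obtains C where "0 \<le> C" "\<And>(x :: 'd::finite point) y. 0 < snd x \<Longrightarrow>
    dominated_kernel n m C x (y, 0) \<bar>modified_poisson_kernel n m x y\<bar>"
proof
  define c where "c = 2 / sphere_area n"
  have c: "0 < c" using n by (simp add: c_def sphere_area_pos)
  define lam where "lam = real n / 2"
  have lam: "0 < lam" using n by (simp add: lam_def)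
  define A where "A k = gegenbauer lam k 1" for k
  have A: "0 \<le> A k" for k using gegenbauer_one_nonneg[OF lam] by (simp add: A_def)
  define S where "S = (\<Sum>k. A k * (1/2) ^ k)"
  have sA: "summable (\<lambda>k. A k * (1/2) ^ k)" unfolding A_def by (rule summable_gegenbauer_one)
  have S: "0 \<le> S" unfolding S_def using A by (intro suminf_nonneg sA) auto
  \<comment> \<open>one summand each for the singular part, the corrections and the tail of the series\<close>
  define C where "C = c * (1 + (\<Sum>k<m. A k) + 2 ^ m * S)"
  have sum_A: "0 \<le> (\<Sum>k<m. A k)" using A by (intro sum_nonneg) auto
  show "0 \<le> C" using c S sum_A by (simp add: C_def)
  fix x :: "'d point" and y :: "real^'d" assume X: "0 < snd x"
  define Y where "Y = (y, 0 :: real)"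
  have nY: "norm Y = norm y" by (simp add: Y_def norm_Pair)
  define t where "t = x \<bullet> Y / (norm x * norm y)"
  have t: "\<bar>t\<bar> \<le> 1" using abs_cosine_le_1[of x Y] by (simp add: t_def nY)
  have xY: "snd x \<le> norm (x - Y)" using snd_le_norm[of "x - Y"] by (simp add: Y_def)
  have x0: "x \<noteq> 0" "x \<noteq> Y" using X by (auto simp: Y_def)
  have R: "riesz_majorant n x Y = 1 / norm (x - Y) ^ n"
    using xY unfolding riesz_majorant_def by (simp only: max_absorb2 power_diff_two_mult[OF n])
  have P: "poisson_kernel n x y = c * snd x * riesz_majorant n x Y"
    unfolding R by (simp add: poisson_kernel_def c_def Y_def)
  have cC: "c \<le> C" "\<And>k. k < m \<Longrightarrow> c * A k \<le> C" "c * (2 ^ m * S) \<le> C"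
    unfolding C_def using c S sum_A A member_le_sum[of _ "{..<m}" A]
    by (auto intro!: mult_left_mono simp: add_increasing2 add_increasing)
  have corr: "(\<Sum>k<m. 2 * snd x * norm x ^ k / (sphere_area n * norm y ^ (n + k)) *
      gegenbauer (real n / 2) k (x \<bullet> (y, 0) / (norm x * norm y))) =
      (\<Sum>k<m. c * snd x * (norm x ^ k / norm y ^ (n + k)) * gegenbauer lam k t)"
    by (simp add: c_def lam_def t_def Y_def)
  have "dominated_kernel n m C x Y \<bar>modified_poisson_kernel n m x y\<bar>"
  proof (cases "norm y \<le> 1")
    case True
    have "\<bar>modified_poisson_kernel n m x y\<bar> = c * (snd x * riesz_majorant n x Y)"
      using True X c P riesz_majorant_nonneg[of n x Y] by (simp add: modified_poisson_kernel_def)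
    also have "\<dots> \<le> C * (snd x * riesz_majorant n x Y)"
      using cC X riesz_majorant_nonneg[of n x Y] by (intro mult_right_mono) auto
    finally show ?thesis using True by (simp add: dominated_kernel_def nY mult_ac)
  next
    case False
    hence y: "1 < norm y" by simp
    let ?s = "\<lambda>k. c * snd x * (norm x ^ k / norm y ^ (n + k)) * gegenbauer lam k t"
    have Pm: "modified_poisson_kernel n m x y = c * snd x * riesz_majorant n x Y - (\<Sum>k<m. ?s k)"
      using False unfolding modified_poisson_kernel_def P corr by simp
    have "\<bar>\<Sum>k<m. ?s k\<bar> \<le> (\<Sum>k<m. C * snd x * (norm x ^ k / norm y ^ (n + k)))"
    proof (rule order_trans[OF sum_abs sum_mono])
      fix k assume k: "k \<in> {..<m}"
      define w where "w = snd x * (norm x ^ k / norm y ^ (n + k))"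
      have w: "0 \<le> w" using X by (simp add: w_def)
      have "\<bar>?s k\<bar> = \<bar>c * gegenbauer lam k t * w\<bar>" by (simp only: w_def mult_ac)
      also have "\<dots> = c * \<bar>gegenbauer lam k t\<bar> * w"
        using c w by (simp only: abs_mult abs_of_pos abs_of_nonneg)
      also have "\<dots> \<le> C * w"
      proof (intro mult_right_mono)
        have "c * \<bar>gegenbauer lam k t\<bar> \<le> c * A k"
          unfolding A_def using c lam t by (intro mult_left_mono abs_gegenbauer_le) auto
        also have "\<dots> \<le> C" using cC k by simp
        finally show "c * \<bar>gegenbauer lam k t\<bar> \<le> C" .
      qed (rule w)
      finally show "\<bar>?s k\<bar> \<le> C * snd x * (norm x ^ k / norm y ^ (n + k))"
        by (simp only: w_def mult.assoc)
    qed
    moreover have "\<bar>c * snd x * riesz_majorant n x Y\<bar> \<le> C * (snd x * riesz_majorant n x Y)"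
      using cC X c riesz_majorant_nonneg[of n x Y]
      by (simp add: abs_mult mult.assoc) (intro mult_right_mono, auto)
    ultimately have 1: "\<bar>modified_poisson_kernel n m x y\<bar> \<le>
        C * snd x * (riesz_majorant n x Y + (\<Sum>k<m. norm x ^ k / norm y ^ (n + k)))"
      unfolding Pm by (simp add: distrib_left sum_distrib_left mult.assoc abs_le_iff)
    have 2: "\<bar>modified_poisson_kernel n m x y\<bar> \<le> C * snd x * (norm x ^ m / norm y ^ (n + m))"
      if far: "2 * norm x \<le> norm y"
    proof -
      define r where "r = norm x / norm y"
      have r: "0 \<le> r" "r \<le> 1/2" using far y by (auto simp: r_def divide_simps)
      have y0: "Y \<noteq> 0" using y nY by auto
      have gen: "(1 - 2 * t * r + r\<^sup>2) powr (- lam) = norm y ^ n / norm (x - Y) ^ n"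
        using gegenbauer_generating_norm[of x Y n] x0 y0 unfolding t_def r_def lam_def nY by blast
      have F: "(\<lambda>k. gegenbauer lam k t * r ^ k) sums (norm y ^ n / norm (x - Y) ^ n)"
        unfolding gen[symmetric] using t r by (intro gegenbauer_sums) auto
      have "\<bar>gegenbauer lam k t\<bar> \<le> A k * 1" for k
        using abs_gegenbauer_le[OF lam t, of k] by (simp add: A_def)
      from power_series_tail[OF F sA this A zero_le_one r, of m]
      have tail: "\<bar>norm y ^ n / norm (x - Y) ^ n - (\<Sum>k<m. gegenbauer lam k t * r ^ k)\<bar> \<le>
          1 * r ^ m * 2 ^ m * S"
        unfolding S_def .
      have pos: "0 \<le> c * snd x / norm y ^ n" using c X by simp
      have e1: "c * snd x * (1 / norm (x - Y) ^ n) =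
          c * snd x / norm y ^ n * (norm y ^ n / norm (x - Y) ^ n)"
        using less_trans[OF zero_less_one y] by (simp add: less_imp_neq[symmetric])
      have e2: "?s k = c * snd x / norm y ^ n * (gegenbauer lam k t * r ^ k)" for k
        using y by (simp add: r_def power_divide power_add)
      have "modified_poisson_kernel n m x y =
          c * snd x / norm y ^ n * (norm y ^ n / norm (x - Y) ^ n - (\<Sum>k<m. gegenbauer lam k t * r ^ k))"
        unfolding Pm R e1 e2 by (simp only: right_diff_distrib sum_distrib_left)
      hence "\<bar>modified_poisson_kernel n m x y\<bar> = c * snd x / norm y ^ n *
          \<bar>norm y ^ n / norm (x - Y) ^ n - (\<Sum>k<m. gegenbauer lam k t * r ^ k)\<bar>"
        by (simp only: abs_mult abs_of_nonneg[OF pos])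
      also have "\<dots> \<le> c * snd x / norm y ^ n * (1 * r ^ m * 2 ^ m * S)"
        by (intro mult_left_mono tail pos)
      also have "\<dots> = c * (2 ^ m * S) * (snd x * (norm x ^ m / norm y ^ (n + m)))"
        by (simp add: r_def power_divide power_add)
      also have "\<dots> \<le> C * (snd x * (norm x ^ m / norm y ^ (n + m)))"
        using cC X by (intro mult_right_mono) auto
      finally show ?thesis by (simp only: mult_ac)
    qed
    show ?thesis using 1 2 False by (simp add: dominated_kernel_def nY)
  qed
  thus "dominated_kernel n m C x (y, 0) \<bar>modified_poisson_kernel n m x y\<bar>" by (simp add: Y_def)
qed

lemma norm_reflect: "norm (reflect y) = norm y"
  by (simp add: reflect_def norm_prod_def)

lemma norm_diff_reflect_sq:
  fixes x y :: "'a::finite point"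
  shows "(norm (x - reflect y))\<^sup>2 = (norm (x - y))\<^sup>2 + 4 * snd x * snd y"
proof -
  have "(norm z)\<^sup>2 = (norm (fst z))\<^sup>2 + (snd z)\<^sup>2" for z :: "'a point"
    by (simp add: norm_prod_def)
  thus ?thesis by (simp add: reflect_def power2_eq_square algebra_simps)
qed

text \<open>Bernoulli's inequality replaces the mean value theorem for \<open>r \<mapsto> r^{-N}\<close>.\<close>

lemma inverse_power_diff_le:
  fixes a b :: real
  assumes "0 < a" "a \<le> b"
  shows "1 / a ^ N - 1 / b ^ N \<le> real N * (b\<^sup>2 - a\<^sup>2) / (a ^ N * b\<^sup>2)"
proof -
  define q where "q = a / b"
  have q: "0 < q" "q \<le> 1" using assms by (auto simp: q_def)
  have "1 + real N * (q - 1) \<le> (1 + (q - 1)) ^ N" using q by (intro Bernoulli_inequality) auto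
  hence "1 - q ^ N \<le> real N * (1 - q)" by (simp add: algebra_simps)
  also have "\<dots> \<le> real N * (1 - q\<^sup>2)"
    using q by (intro mult_left_mono) (auto simp: power2_eq_square mult_left_le)
  finally have "(1 - q ^ N) / a ^ N \<le> real N * (1 - q\<^sup>2) / a ^ N"
    using assms by (intro divide_right_mono) auto
  thus ?thesis
    using assms by (simp add: q_def power_divide diff_divide_distrib right_diff_distrib mult.commute)
qed

text \<open>
  The gain of $x_ny_n$ over the single fundamental solutions comes from
  $|x-y^*|^2 - |x-y|^2 = 4x_ny_n$.
\<close>

lemma green_function_bound:
  fixes x y :: "'d::finite point"
  assumes n: "2 \<le> n" and x: "0 < snd x" and y: "0 < snd y" and xy: "x \<noteq> y"
  shows "0 \<le> 1 / norm (x - y) ^ (n - 2) - 1 / norm (x - reflect y) ^ (n - 2)"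
    and "1 / norm (x - y) ^ (n - 2) - 1 / norm (x - reflect y) ^ (n - 2) \<le>
      4 * real (n - 2) * snd x * snd y * riesz_majorant n x y"
proof -
  define a b N where "a = norm (x - y)" and "b = norm (x - reflect y)" and "N = n - 2"
  have a: "0 < a" using xy by (simp add: a_def)
  have b2: "b\<^sup>2 = a\<^sup>2 + 4 * snd x * snd y" by (simp add: a_def b_def norm_diff_reflect_sq)
  have ab: "a \<le> b" by (rule power2_le_imp_le) (use b2 x y in \<open>auto simp: b_def\<close>)
  show "0 \<le> 1 / norm (x - y) ^ (n - 2) - 1 / norm (x - reflect y) ^ (n - 2)"
    using a ab unfolding a_def[symmetric] b_def[symmetric] by (simp add: frac_le power_mono)
  have "snd x \<le> b" using snd_le_norm[of "x - reflect y"] y by (simp add: b_def reflect_def)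
  hence mb: "(max (snd x) a)\<^sup>2 \<le> b\<^sup>2" using ab a by (intro power_mono) auto
  have m0: "0 < (max (snd x) a)\<^sup>2" using x by (auto simp: max_def)
  have "1 / a ^ N - 1 / b ^ N \<le> real N * (b\<^sup>2 - a\<^sup>2) / (a ^ N * b\<^sup>2)"
    using a ab by (rule inverse_power_diff_le)
  also have "\<dots> = real N * (4 * snd x * snd y) / (a ^ N * b\<^sup>2)" by (simp add: b2)
  also have "\<dots> \<le> real N * (4 * snd x * snd y) / (a ^ N * (max (snd x) a)\<^sup>2)"
    using x y a m0 mb by (intro divide_left_mono mult_left_mono mult_pos_pos) auto
  also have "\<dots> = 4 * real N * snd x * snd y * riesz_majorant n x y"
    by (simp add: riesz_majorant_def a_def N_def)
  finally show "1 / norm (x - y) ^ (n - 2) - 1 / norm (x - reflect y) ^ (n - 2) \<le>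
      4 * real (n - 2) * snd x * snd y * riesz_majorant n x y"
    by (simp only: a_def b_def N_def)
qed

text \<open>
  As for the Poisson kernel, with the difference of the polynomials at the two cosines \<open>t\<close> and \<open>t'\<close> as
  coefficients. The constant polynomial of degree 0 cancels, so the $m+1$ correction terms
  contribute \<open>m\<close> differences; and $|t-t'| = 2x_ny_n/(|x||y|)$ turns the term of degree $k+1$ into
  one of size $x_ny_n|x|^k/|y|^{n+k}$.
\<close>

lemma modified_green_dominated:
  assumes n: "3 \<le> n"
  obtains C where "0 \<le> C" "\<And>x y :: 'd::finite point. 0 < snd x \<Longrightarrow> 0 < snd y \<Longrightarrow> x \<noteq> y \<Longrightarrow>
    \<exists>g. modified_green n m x y = ereal g \<and> dominated_kernel n m C x y (\<bar>g\<bar> / snd y)"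
proof
  define c where "c = riesz_const n"
  have c: "0 < c" using n by (simp add: c_def riesz_const_pos)
  define lam where "lam = real (n - 2) / 2"
  have lam: "0 < lam" "(real n - 2) / 2 = lam" using n by (auto simp: lam_def of_nat_diff)
  define A where "A k = (real k)\<^sup>2 * gegenbauer lam k 1" for k
  have A: "0 \<le> A k" for k using gegenbauer_one_nonneg[OF lam(1)] by (simp add: A_def)
  define S where "S = (\<Sum>k. A k * (1/2) ^ k)"
  have sA: "summable (\<lambda>k. A k * (1/2) ^ k)"
    unfolding A_def using lam(1) by (rule summable_sq_gegenbauer_one)
  have S: "0 \<le> S" unfolding S_def using A by (intro suminf_nonneg sA) auto
  \<comment> \<open>one summand each for the singular part, the corrections and the tail of the series\<close>
  define C where "C = c * (4 * real (n - 2) + 2 * (\<Sum>k<m. A (Suc k)) + 2 * (2 ^ Suc m * S))"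
  have sum_A: "0 \<le> (\<Sum>k<m. A (Suc k))" using A by (intro sum_nonneg) auto
  have cC: "c * (4 * real (n - 2)) \<le> C" "\<And>k. k < m \<Longrightarrow> c * (2 * A (Suc k)) \<le> C"
    "c * (2 * (2 ^ Suc m * S)) \<le> C"
  proof -
    have "k < m \<Longrightarrow> A (Suc k) \<le> (\<Sum>k<m. A (Suc k))" for k
      using A by (intro member_le_sum) auto
    thus "c * (4 * real (n - 2)) \<le> C" "\<And>k. k < m \<Longrightarrow> c * (2 * A (Suc k)) \<le> C"
      "c * (2 * (2 ^ Suc m * S)) \<le> C"
      unfolding C_def using c S sum_A by (auto intro!: mult_left_mono simp: add_increasing2 add_increasing)
  qed
  show C0: "0 \<le> C" using c S sum_A by (simp add: C_def)
  fix x y :: "'d point" assume x: "0 < snd x" and y: "0 < snd y" and xy: "x \<noteq> y"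
  define Y where "Y = reflect y"
  have nY: "norm Y = norm y" by (simp add: Y_def norm_reflect)
  have xY: "x \<noteq> Y" using x y by (auto simp: Y_def reflect_def)
  have x0: "x \<noteq> 0" and y0: "y \<noteq> 0" "Y \<noteq> 0" using x y by (auto simp: Y_def reflect_def prod_eq_iff)
  have nx: "0 < norm x" and ny: "0 < norm y" using x0 y0 by auto
  define t t' where "t = x \<bullet> y / (norm x * norm y)" and "t' = x \<bullet> Y / (norm x * norm y)"
  have t: "\<bar>t\<bar> \<le> 1" "\<bar>t'\<bar> \<le> 1"
    using abs_cosine_le_1[of x y] abs_cosine_le_1[of x Y] by (auto simp: t_def t'_def nY)
  have "t - t' = 2 * snd x * snd y / (norm x * norm y)"
    unfolding t_def t'_def diff_divide_distrib[symmetric]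
    by (simp add: Y_def reflect_def inner_prod_def)
  hence tt: "\<bar>t - t'\<bar> = 2 * snd x * snd y / (norm x * norm y)"
    using x y by simp
  define D where "D k = gegenbauer lam k t - gegenbauer lam k t'" for k
  have D: "\<bar>D k\<bar> \<le> A k * \<bar>t - t'\<bar>" for k
    unfolding D_def A_def using lam(1) t by (rule gegenbauer_lipschitz)
  define B where "B = 1 / norm (x - y) ^ (n - 2) - 1 / norm (x - Y) ^ (n - 2)"
  have B: "0 \<le> B" "B \<le> 4 * real (n - 2) * snd x * snd y * riesz_majorant n x y"
    using green_function_bound[OF _ x y xy, of n] n by (auto simp: B_def Y_def)
  let ?s = "\<lambda>k. c * (norm x ^ k / norm y ^ (n - 2 + k)) * D k"
  define g where "g = - c * B + (if norm y \<le> 1 then 0 else \<Sum>k<Suc m. ?s k)"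
  have E: "fundamental_solution n z = ereal (- c * (1 / norm z ^ (n - 2)))" if "z \<noteq> 0" for z :: "'d point"
  proof -
    have "norm z powr (2 - real n) = norm z powr (- real (n - 2))" using n by (simp add: of_nat_diff)
    also have "\<dots> = 1 / norm z ^ (n - 2)" using that by (simp add: powr_minus_divide powr_realpow)
    finally show ?thesis using that by (simp add: fundamental_solution_def c_def)
  qed
  let ?U = "\<lambda>t. \<Sum>k<Suc m. c * norm x ^ k / norm y ^ (n - 2 + k) * gegenbauer lam k t"
  have split: "(\<Sum>k<Suc m. ?s k) = ?U t - ?U t'"
    by (simp add: D_def right_diff_distrib sum_subtractf del: sum.lessThan_Suc)
  have G: "modified_green n m x y = ereal g"
    using xy xY
    unfolding modified_green_def modified_fundamental_solution_def Y_def[symmetric] nY lam(2)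
      t_def[symmetric] t'_def[symmetric] c_def[symmetric] g_def split
    by (simp add: E B_def right_diff_distrib del: sum.lessThan_Suc)
  have main: "dominated_kernel n m C x y (\<bar>g\<bar> / snd y)"
  proof (cases "norm y \<le> 1")
    case True
    have "\<bar>g\<bar> = c * B" using True c B by (simp add: g_def)
    also have "\<dots> \<le> c * (4 * real (n - 2) * snd x * snd y * riesz_majorant n x y)"
      using c B by (intro mult_left_mono) auto
    also have "\<dots> = c * (4 * real (n - 2)) * (snd x * riesz_majorant n x y * snd y)"
      by (simp only: mult_ac)
    also have "\<dots> \<le> C * (snd x * riesz_majorant n x y * snd y)"
      using cC x y riesz_majorant_nonneg[of n x y] by (intro mult_right_mono) auto
    finally have "\<bar>g\<bar> / snd y \<le> C * (snd x * riesz_majorant n x y)"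
      using y by (simp add: pos_divide_le_eq mult_ac)
    thus ?thesis using True by (simp add: dominated_kernel_def mult_ac)
  next
    case False
    hence ny1: "1 < norm y" by simp
    have s: "\<bar>?s (Suc k)\<bar> \<le> c * (2 * A (Suc k)) * (snd x * (norm x ^ k / norm y ^ (n + k)) * snd y)" for k
    proof -
      define w where "w = norm x ^ Suc k / norm y ^ (n - 2 + Suc k)"
      have w: "0 \<le> w" by (simp add: w_def)
      have nk: "n + k = Suc (n - 2 + Suc k)" using n by simp
      have e: "norm y ^ (n - 2 + Suc k) * norm y = norm y ^ (n + k)"
        unfolding nk by (simp only: power_Suc2)
      have "\<bar>?s (Suc k)\<bar> = c * w * \<bar>D (Suc k)\<bar>"
        unfolding w_def[symmetric] using c w by (simp only: abs_mult abs_of_pos abs_of_nonneg)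
      also have "\<dots> \<le> c * w * (A (Suc k) * \<bar>t - t'\<bar>)"
        using c w D by (intro mult_left_mono) auto
      also have "\<dots> = c * (2 * A (Suc k)) * (snd x * (norm x ^ k / (norm y ^ (n - 2 + Suc k) * norm y)) * snd y)"
        unfolding tt w_def using nx by (simp add: mult_ac)
      finally show ?thesis unfolding e .
    qed
    \<comment> \<open>the Lipschitz constant of the constant polynomial is 0\<close>
    have D0: "?s 0 = 0" using D[of 0] by (simp add: A_def)
    have g: "g = - c * B + (\<Sum>k<m. ?s (Suc k))"
      using False D0 by (simp add: g_def sum.lessThan_Suc_shift del: sum.lessThan_Suc)
    have "\<bar>\<Sum>k<m. ?s (Suc k)\<bar> \<le> (\<Sum>k<m. C * (snd x * (norm x ^ k / norm y ^ (n + k)) * snd y))"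
    proof (rule order_trans[OF sum_abs sum_mono])
      fix k assume "k \<in> {..<m}"
      hence "c * (2 * A (Suc k)) * (snd x * (norm x ^ k / norm y ^ (n + k)) * snd y) \<le>
          C * (snd x * (norm x ^ k / norm y ^ (n + k)) * snd y)"
        using cC x y by (intro mult_right_mono) auto
      with s show "\<bar>?s (Suc k)\<bar> \<le> C * (snd x * (norm x ^ k / norm y ^ (n + k)) * snd y)"
        by (rule order_trans)
    qed
    also have "\<dots> = C * (snd x * (\<Sum>k<m. norm x ^ k / norm y ^ (n + k)) * snd y)"
      by (simp only: sum_distrib_left sum_distrib_right)
    finally have corr: "\<bar>\<Sum>k<m. ?s (Suc k)\<bar> \<le>
        C * (snd x * (\<Sum>k<m. norm x ^ k / norm y ^ (n + k)) * snd y)" .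
    have "c * B \<le> c * (4 * real (n - 2) * snd x * snd y * riesz_majorant n x y)"
      using c B by (intro mult_left_mono) auto
    also have "\<dots> = c * (4 * real (n - 2)) * (snd x * riesz_majorant n x y * snd y)"
      by (simp only: mult_ac)
    also have "\<dots> \<le> C * (snd x * riesz_majorant n x y * snd y)"
      using cC x y riesz_majorant_nonneg[of n x y] by (intro mult_right_mono) auto
    finally have base: "c * B \<le> C * (snd x * riesz_majorant n x y * snd y)" .
    have "\<bar>g\<bar> \<le> c * B + \<bar>\<Sum>k<m. ?s (Suc k)\<bar>"
      unfolding g using c B abs_triangle_ineq[of "- c * B" "\<Sum>k<m. ?s (Suc k)"]
      by (simp add: abs_mult)
    also have "\<dots> \<le> C * (snd x * riesz_majorant n x y * snd y) +
        C * (snd x * (\<Sum>k<m. norm x ^ k / norm y ^ (n + k)) * snd y)"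
      by (intro add_mono base corr)
    also have "\<dots> = C * snd x * (riesz_majorant n x y + (\<Sum>k<m. norm x ^ k / norm y ^ (n + k))) * snd y"
      by (simp only: distrib_left distrib_right mult_ac)
    finally have 1: "\<bar>g\<bar> / snd y \<le>
        C * snd x * (riesz_majorant n x y + (\<Sum>k<m. norm x ^ k / norm y ^ (n + k)))"
      using y by (simp only: pos_divide_le_eq)
    have 2: "\<bar>g\<bar> / snd y \<le> C * snd x * (norm x ^ m / norm y ^ (n + m))"
      if far: "2 * norm x \<le> norm y"
    proof -
      define r where "r = norm x / norm y"
      have r: "0 \<le> r" "r \<le> 1/2" using far ny by (auto simp: r_def divide_simps)
      have rr: "\<bar>r\<bar> < 1" using r by simp
      have gen: "(1 - 2 * t * r + r\<^sup>2) powr (- lam) = norm y ^ (n - 2) / norm (x - y) ^ (n - 2)"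
        "(1 - 2 * t' * r + r\<^sup>2) powr (- lam) = norm y ^ (n - 2) / norm (x - Y) ^ (n - 2)"
        using gegenbauer_generating_norm[of x y "n - 2"] gegenbauer_generating_norm[of x Y "n - 2"] x0 y0 xy xY
        unfolding t_def t'_def r_def lam_def nY by blast+
      have F: "(\<lambda>k. D k * r ^ k) sums (norm y ^ (n - 2) * B)"
        using sums_diff[OF gegenbauer_sums[OF t(1) rr, of lam] gegenbauer_sums[OF t(2) rr, of lam]]
        unfolding gen D_def B_def by (simp add: left_diff_distrib right_diff_distrib)
      note tail = power_series_tail[OF F sA D A abs_ge_zero r, of "Suc m", folded S_def]
      have pos: "0 \<le> c / norm y ^ (n - 2)" using c by simp
      have e1: "c * B = c / norm y ^ (n - 2) * (norm y ^ (n - 2) * B)" using y0 by simp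
      have e2: "?s k = c / norm y ^ (n - 2) * (D k * r ^ k)" for k
        by (simp add: r_def power_divide power_add)
      have "g = - c * B + (\<Sum>k<Suc m. ?s k)" using False by (simp add: g_def)
      also have "\<dots> = - (c / norm y ^ (n - 2) * (norm y ^ (n - 2) * B - (\<Sum>k<Suc m. D k * r ^ k)))"
        unfolding e2 mult_minus_left e1 by (simp only: right_diff_distrib sum_distrib_left minus_diff_eq)
      finally have "\<bar>g\<bar> = c / norm y ^ (n - 2) * \<bar>norm y ^ (n - 2) * B - (\<Sum>k<Suc m. D k * r ^ k)\<bar>"
        by (simp only: abs_minus_cancel abs_mult abs_of_nonneg[OF pos])
      also have "\<dots> \<le> c / norm y ^ (n - 2) * (\<bar>t - t'\<bar> * r ^ Suc m * 2 ^ Suc m * S)"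
        by (intro mult_left_mono tail pos)
      also have "\<dots> = c * (2 * (2 ^ Suc m * S)) *
          (snd x * (norm x ^ m / (norm y ^ (n - 2) * norm y ^ 2 * norm y ^ m)) * snd y)"
        unfolding tt r_def using nx by (simp add: power_divide power2_eq_square mult_ac)
      also have "\<dots> = c * (2 * (2 ^ Suc m * S)) * (snd x * (norm x ^ m / norm y ^ (n + m)) * snd y)"
        using n by (simp only: power_diff_two_mult power_add)
      also have "\<dots> \<le> C * (snd x * (norm x ^ m / norm y ^ (n + m)) * snd y)"
        using cC x y by (intro mult_right_mono) auto
      finally have "\<bar>g\<bar> \<le> C * snd x * (norm x ^ m / norm y ^ (n + m)) * snd y"
        by (simp only: mult.assoc)
      thus ?thesis using y by (simp only: pos_divide_le_eq)
    qed
    show ?thesis using 1 2 False by (simp add: dominated_kernel_def)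
  qed
  show "\<exists>g. modified_green n m x y = ereal g \<and> dominated_kernel n m C x y (\<bar>g\<bar> / snd y)"
    using G main by blast
qed

section \<open>Covering points of high concentration\<close>

text \<open>
  Vitali's covering lemma needs bounded radii, so it is applied in each dyadic annulus separately. It
  gives disjoint balls, whose measures add up to at most the measure of that annulus and its two
  neighbours, because the radii are at most $|x|/2$; summing over the annuli counts every point at
  most three times.
\<close>

lemma concentration_cover:
  fixes N :: "'a::euclidean_space measure" and S :: "'a set" and \<beta> :: real
  assumes fin: "finite_measure N" and sets: "sets N = sets borel"
    and S: "\<And>x. x \<in> S \<Longrightarrow> 1 \<le> norm x \<and>
      (\<exists>r. 0 < r \<and> r \<le> norm x / 2 \<and> (r / norm x) powr \<beta> < measure N (ball x r))"
  obtains C \<rho> where "countable C" "C \<subseteq> S" "\<And>x. x \<in> C \<Longrightarrow> 0 < \<rho> x"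
    "S \<subseteq> (\<Union>x\<in>C. ball x (\<rho> x))" "(\<lambda>x. (\<rho> x / norm x) powr \<beta>) summable_on C"
proof -
  interpret finite_measure N by fact
  have meas [simp]: "A \<in> sets N" if "A \<in> sets borel" for A using that sets by simp
  from S have "\<exists>r. \<forall>x\<in>S. 0 < r x \<and> r x \<le> norm x / 2 \<and> (r x / norm x) powr \<beta> < measure N (ball x (r x))"
    by (intro bchoice) blast
  then obtain r where r: "\<And>x. x \<in> S \<Longrightarrow> 0 < r x" "\<And>x. x \<in> S \<Longrightarrow> r x \<le> norm x / 2"
    "\<And>x. x \<in> S \<Longrightarrow> (r x / norm x) powr \<beta> < measure N (ball x (r x))" by blast
  define T where "T i = {x \<in> S. 2 ^ i \<le> norm x \<and> norm x < 2 ^ Suc i}" for i :: nat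
  have "\<forall>i. \<exists>C. countable C \<and> C \<subseteq> T i \<and>
      pairwise (\<lambda>x y. disjnt (ball x (r x)) (ball y (r y))) C \<and>
      (\<forall>x\<in>T i. \<exists>y\<in>C. x \<in> ball y (5 * r y))"
  proof
    fix i
    have "0 < r x \<and> r x \<le> 2 ^ i" if "x \<in> T i" for x
      using that r(1)[of x] r(2)[of x] by (auto simp: T_def)
    then obtain C where C: "countable C" "C \<subseteq> T i"
      "pairwise (\<lambda>x y. disjnt (cball x (r x)) (cball y (r y))) C"
      "\<And>x. x \<in> T i \<Longrightarrow> \<exists>y. y \<in> C \<and> \<not> disjnt (cball x (r x)) (cball y (r y)) \<and>
        cball x (r x) \<subseteq> ball y (5 * r y)"
      by (rule Vitali_covering_lemma_cballs_balls[of "T i" r "2 ^ i" "\<lambda>x. x"]) (assumption | rule that)+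
    have "pairwise (\<lambda>x y. disjnt (ball x (r x)) (ball y (r y))) C"
      using C(3) ball_subset_cball unfolding pairwise_def disjnt_def by blast
    moreover have "\<exists>y\<in>C. x \<in> ball y (5 * r y)" if "x \<in> T i" for x
    proof -
      have "x \<in> cball x (r x)" using r(1)[of x] that by (simp add: T_def less_imp_le)
      thus ?thesis using C(4)[OF that] by blast
    qed
    ultimately show "\<exists>C. countable C \<and> C \<subseteq> T i \<and>
        pairwise (\<lambda>x y. disjnt (ball x (r x)) (ball y (r y))) C \<and>
        (\<forall>x\<in>T i. \<exists>y\<in>C. x \<in> ball y (5 * r y))"
      using C(1,2) by blast
  qed
  hence "\<exists>C. \<forall>i. countable (C i) \<and> C i \<subseteq> T i \<and>
      pairwise (\<lambda>x y. disjnt (ball x (r x)) (ball y (r y))) (C i) \<and>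
      (\<forall>x\<in>T i. \<exists>y\<in>C i. x \<in> ball y (5 * r y))"
    by (rule choice)
  then obtain C where C_all: "\<forall>i. countable (C i) \<and> C i \<subseteq> T i \<and>
      pairwise (\<lambda>x y. disjnt (ball x (r x)) (ball y (r y))) (C i) \<and>
      (\<forall>x\<in>T i. \<exists>y\<in>C i. x \<in> ball y (5 * r y))"
    by (rule exE)
  have C: "countable (C i)" "C i \<subseteq> T i"
    "pairwise (\<lambda>x y. disjnt (ball x (r x)) (ball y (r y))) (C i)"
    "x \<in> T i \<Longrightarrow> \<exists>y\<in>C i. x \<in> ball y (5 * r y)" for i x
    using C_all[THEN spec, of i] by simp_all
  let ?C = "\<Union>i. C i"
  define D where "D j = {y :: 'a. 2 ^ j \<le> 2 * norm y \<and> 2 * norm y < 2 ^ Suc j}" for j :: nat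
  have D_meas [simp]: "D j \<in> sets N" for j
    unfolding D_def by (intro meas) measurable
  have D_disj: "disjoint_family (\<lambda>i. D (i + c))" for c
    unfolding disjoint_family_on_def
  proof (intro ballI impI)
    fix i j :: nat assume "i \<noteq> j"
    moreover have False if "i < j" "y \<in> D (i + c)" "y \<in> D (j + c)" for i j y
    proof -
      have "2 ^ Suc (i + c) \<le> (2::real) ^ (j + c)" using that(1) by (intro power_increasing) auto
      thus False using that by (simp add: D_def)
    qed
    ultimately show "D (i + c) \<inter> D (j + c) = {}" by (metis disjoint_iff linorder_neqE_nat)
  qed
  have D_sum: "(\<Sum>i<I. measure N (D (i + c))) \<le> measure N (space N)" for I c
  proof -
    have "(\<Sum>i<I. measure N (D (i + c))) = measure N (\<Union>i<I. D (i + c))"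
      using D_disj by (intro finite_measure_finite_Union[symmetric])
        (auto simp: disjoint_family_on_def)
    thus ?thesis by (simp add: bounded_measure)
  qed
  have ball_D: "ball x (r x) \<subseteq> D i \<union> D (i + 1) \<union> D (i + 2)" if "x \<in> T i" for x i
  proof
    fix y assume y: "y \<in> ball x (r x)"
    have x: "x \<in> S" "2 ^ i \<le> norm x" "norm x < 2 * 2 ^ i" using that by (auto simp: T_def)
    have "\<bar>norm x - norm y\<bar> < norm x / 2"
      using y r(2)[OF x(1)] norm_triangle_ineq3[of x y] by (simp add: dist_norm)
    hence "norm x / 2 < norm y" "norm y < 3 / 2 * norm x" by linarith+
    hence "2 ^ i \<le> 2 * norm y" "2 * norm y < 8 * 2 ^ i" using x by auto
    thus "y \<in> D i \<union> D (i + 1) \<union> D (i + 2)" by (auto simp: D_def)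
  qed
  have sum_C: "(\<Sum>x\<in>F. (r x / norm x) powr \<beta>) \<le>
      measure N (D i) + measure N (D (i + 1)) + measure N (D (i + 2))"
    if F: "finite F" "F \<subseteq> C i" for F i
  proof -
    have FS: "x \<in> T i" "x \<in> S" if "x \<in> F" for x
      using that F C(2)[of i] by (auto simp: T_def)
    have "(\<Sum>x\<in>F. (r x / norm x) powr \<beta>) \<le> (\<Sum>x\<in>F. measure N (ball x (r x)))"
      using r(3) FS by (intro sum_mono less_imp_le) auto
    also have "\<dots> = measure N (\<Union>x\<in>F. ball x (r x))"
      using F pairwise_subset[OF C(3)[of i] F(2)]
      by (intro finite_measure_finite_Union[symmetric])
         (auto simp: disjoint_family_on_def pairwise_def disjnt_def)
    also have "\<dots> \<le> measure N (D i \<union> D (i + 1) \<union> D (i + 2))"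
    proof (rule finite_measure_mono)
      show "(\<Union>x\<in>F. ball x (r x)) \<subseteq> D i \<union> D (i + 1) \<union> D (i + 2)"
        using ball_D FS by blast
    qed (intro sets.Un D_meas)
    also have "\<dots> \<le> measure N (D i \<union> D (i + 1)) + measure N (D (i + 2))"
      by (intro measure_Un_le) auto
    also have "\<dots> \<le> measure N (D i) + measure N (D (i + 1)) + measure N (D (i + 2))"
      by (intro add_right_mono measure_Un_le) auto
    finally show ?thesis .
  qed
  have bound: "(\<Sum>x\<in>F. (r x / norm x) powr \<beta>) \<le> 3 * measure N (space N)"
    if F: "finite F" "F \<subseteq> ?C" for F
  proof -
    have "\<exists>I. F \<subseteq> (\<Union>i<I. C i)"
      using F
    proof (induction F rule: finite_induct)
      case (insert x F)
      then obtain I i where I: "F \<subseteq> (\<Union>i<I. C i)" "x \<in> C i" by auto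
      have "insert x F \<subseteq> (\<Union>i<max I (Suc i). C i)" using I by (fastforce simp: less_max_iff_disj)
      thus ?case by blast
    qed auto
    then obtain I where I: "F \<subseteq> (\<Union>i<I. C i)" by blast
    let ?t = "\<lambda>x. (r x / norm x) powr \<beta>"
    have "(\<Sum>x\<in>F. ?t x) \<le> (\<Sum>x\<in>F. \<Sum>i<I. if x \<in> C i then ?t x else 0)"
    proof (rule sum_mono)
      fix x assume "x \<in> F"
      then obtain i where i: "i < I" "x \<in> C i" using I by blast
      have "?t x = (if x \<in> C i then ?t x else 0)" using i by simp
      also have "\<dots> \<le> (\<Sum>i<I. if x \<in> C i then ?t x else 0)"
        using i by (intro member_le_sum) auto
      finally show "?t x \<le> (\<Sum>i<I. if x \<in> C i then ?t x else 0)" .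
    qed
    also have "\<dots> = (\<Sum>i<I. \<Sum>x\<in>F \<inter> C i. ?t x)"
      unfolding sum.swap[of _ "{..<I}"] using F by (simp add: sum.inter_restrict)
    also have "\<dots> \<le> (\<Sum>i<I. measure N (D (i + 0)) + measure N (D (i + 1)) + measure N (D (i + 2)))"
      using F sum_C by (intro sum_mono) auto
    also have "\<dots> \<le> 3 * measure N (space N)"
      unfolding sum.distrib using D_sum[of 0 I] D_sum[of 1 I] D_sum[of 2 I] by linarith
    finally show ?thesis .
  qed
  show thesis
  proof (rule that[of ?C "\<lambda>x. 5 * r x"])
    show "countable ?C" using C(1) by blast
    show CS: "?C \<subseteq> S" using C(2) by (auto simp: T_def)
    show "0 < 5 * r x" if "x \<in> ?C" for x using that CS r(1) by auto
    show "S \<subseteq> (\<Union>x\<in>?C. ball x (5 * r x))"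
    proof
      fix x assume x: "x \<in> S"
      \<comment> \<open>the dyadic annulus of \<open>x\<close>\<close>
      define i where "i = nat \<lfloor>log 2 (norm x)\<rfloor>"
      have x1: "1 \<le> norm x" using S[OF x] by blast
      hence x0: "0 < norm x" by linarith
      hence "0 \<le> log 2 (norm x)" using x1 by simp
      hence "real i = of_int \<lfloor>log 2 (norm x)\<rfloor>" unfolding i_def by (subst of_nat_nat) simp_all
      hence "real i \<le> log 2 (norm x)" "log 2 (norm x) < real (Suc i)" by linarith+
      hence "2 powr real i \<le> norm x" "norm x < 2 powr real (Suc i)"
        using le_log_iff[of 2 "norm x" "real i"] log_less_iff[of 2 "norm x" "real (Suc i)"] x0 by simp_all
      hence "2 ^ i \<le> norm x" "norm x < 2 ^ Suc i" by (simp_all only: powr_realpow zero_less_numeral)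
      hence "x \<in> T i" using x by (simp add: T_def)
      from C(4)[OF this] show "x \<in> (\<Union>x\<in>?C. ball x (5 * r x))" by blast
    qed
    have "(\<lambda>x. (r x / norm x) powr \<beta>) summable_on ?C"
      using bound by (intro nonneg_bdd_above_summable_on bdd_aboveI2) auto
    hence "(\<lambda>x. 5 powr \<beta> * (r x / norm x) powr \<beta>) summable_on ?C"
      by (rule summable_on_cmult_right)
    thus "(\<lambda>x. (5 * r x / norm x) powr \<beta>) summable_on ?C"
      by (rule summable_on_cong[THEN iffD1, rotated])
        (use CS r(1) in \<open>auto simp: powr_mult[symmetric] less_imp_le\<close>)
  qed
qed


lemma finite_measure_tail:
  fixes N :: "'a::euclidean_space measure"
  assumes fin: "finite_measure N" and sets: "sets N = sets borel" and e: "0 < e"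
  shows "\<exists>R. measure N {y. R \<le> norm y} < e"
proof -
  interpret finite_measure N by fact
  have "{y :: 'a. real i \<le> norm y} \<in> sets N" for i
    unfolding sets by (intro borel_closed closed_Collect_le continuous_intros)
  hence "(\<lambda>i. measure N {y. real i \<le> norm y}) \<longlonglongrightarrow> measure N (\<Inter>i. {y. real i \<le> norm y})"
    by (intro finite_Lim_measure_decseq) (auto simp: decseq_def)
  also have "(\<Inter>i. {y :: 'a. real i \<le> norm y}) = {}"
  proof (rule equals0I)
    fix y :: 'a assume "y \<in> (\<Inter>i. {y. real i \<le> norm y})"
    moreover obtain i where "norm y < real i" using reals_Archimedean2 by blast
    ultimately show False by (simp add: not_le[symmetric])
  qed
  finally have "eventually (\<lambda>i. measure N {y. real i \<le> norm y} < e) sequentially"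
    using e by (simp add: order_tendstoD)
  thus ?thesis by (auto simp: eventually_sequentially)
qed

text \<open>
  The weight counts the thresholds \<open>R k\<close> below $|y|$, where the mass beyond \<open>R k\<close> is less than
  $2^{-k}$.
\<close>

lemma unbounded_integrable_weight:
  fixes N :: "'a::euclidean_space measure"
  assumes fin: "finite_measure N" and sets: "sets N = sets borel"
  obtains w :: "'a \<Rightarrow> ennreal" where "w \<in> borel_measurable borel" "(\<integral>\<^sup>+y. w y \<partial>N) < \<infinity>"
    "\<And>K :: nat. \<exists>R. \<forall>y. R \<le> norm y \<longrightarrow> of_nat K \<le> w y"
proof -
  interpret finite_measure N by fact
  have "\<forall>k. \<exists>R. measure N {y. R \<le> norm y} < (1/2) ^ k"
    using finite_measure_tail[OF fin sets] by simp
  then obtain R where R: "\<And>k. measure N {y. R k \<le> norm y} < (1/2) ^ k" by metis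
  define w :: "'a \<Rightarrow> ennreal" where "w y = (\<Sum>k. indicator {y. R k \<le> norm y} y)" for y
  have [measurable]: "{y. R k \<le> norm y} \<in> sets N" for k unfolding sets by measurable
  show thesis
  proof (rule that[of w])
    show "w \<in> borel_measurable borel" unfolding w_def by measurable
    have "(\<integral>\<^sup>+y. w y \<partial>N) = (\<Sum>k. emeasure N {y. R k \<le> norm y})"
      unfolding w_def by (subst nn_integral_suminf) auto
    also have "\<dots> \<le> (\<Sum>k. ennreal ((1/2) ^ k))"
      using R by (intro suminf_le) (auto simp: emeasure_eq_measure less_imp_le intro!: ennreal_leI)
    also have "\<dots> < \<infinity>"
      using summable_geometric[of "1/2 :: real"] by (subst suminf_ennreal2) auto
    finally show "(\<integral>\<^sup>+y. w y \<partial>N) < \<infinity>" .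
    fix K :: nat
    show "\<exists>R. \<forall>y. R \<le> norm y \<longrightarrow> of_nat K \<le> w y"
    proof (intro exI allI impI)
      fix y :: 'a assume y: "(\<Sum>k<K. \<bar>R k\<bar>) \<le> norm y"
      have "R k \<le> norm y" if "k < K" for k
        using member_le_sum[of k "{..<K}" "\<lambda>k. \<bar>R k\<bar>"] that y by auto
      hence "of_nat K = (\<Sum>k<K. indicator {y. R k \<le> norm y} y :: ennreal)" by simp
      also have "\<dots> \<le> w y" unfolding w_def by (intro sum_le_suminf) auto
      finally show "of_nat K \<le> w y" .
    qed
  qed
qed

text \<open>
  The points where the measure is concentrated at level \<open>\<epsilon>\<close> depend on \<open>\<epsilon>\<close>, but one family of balls has
  to serve all levels. The covering is therefore applied at level 1 to the measure with an
  unbounded weight that keeps it finite: where the weight exceeds $1/\epsilon$, level 1 for the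
  weighted measure implies level \<open>\<epsilon>\<close> for the original one.
\<close>

lemma exceptional_balls:
  fixes N :: "'a::euclidean_space measure" and S :: "'a set"
  assumes fin: "finite_measure N" and sets: "sets N = sets borel"
  obtains J :: "nat set" and c :: "nat \<Rightarrow> 'a" and \<rho> :: "nat \<Rightarrow> real" where
    "\<And>j. j \<in> J \<Longrightarrow> c j \<in> S \<and> 0 < \<rho> j"
    "(\<lambda>j. \<rho> j powr \<beta> / norm (c j) powr \<beta>) summable_on J"
    "\<And>\<epsilon>. 0 < \<epsilon> \<Longrightarrow> \<exists>R. \<forall>x \<in> S - (\<Union>j\<in>J. ball (c j) (\<rho> j)). R \<le> norm x \<longrightarrow>
      (\<forall>r. 0 < r \<and> r \<le> norm x / 2 \<longrightarrow> measure N (ball x r) \<le> \<epsilon> * (r / norm x) powr \<beta>)"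
proof -
  interpret finite_measure N by fact
  have meas [simp]: "A \<in> sets N" if "A \<in> sets borel" for A using that sets by simp
  obtain w :: "'a \<Rightarrow> ennreal" where w [measurable]: "w \<in> borel_measurable borel" and
    w_fin: "(\<integral>\<^sup>+y. w y \<partial>N) < \<infinity>" and w_inf: "\<And>K :: nat. \<exists>R. \<forall>y. R \<le> norm y \<longrightarrow> of_nat K \<le> w y"
    using unbounded_integrable_weight[OF fin sets] by blast
  have wN [measurable]: "w \<in> borel_measurable N" using w by (simp add: measurable_cong_sets[OF sets refl])
  define N' where "N' = density N w"
  have sets': "sets N' = sets borel" by (simp add: N'_def sets)
  have "emeasure N' (space N') = (\<integral>\<^sup>+y. w y \<partial>N)"
    unfolding N'_def space_density by (subst emeasure_density) (auto intro!: nn_integral_cong)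
  hence fin': "finite_measure N'" using w_fin by (intro finite_measureI) auto
  define B where "B = {x \<in> S. 1 \<le> norm x \<and>
      (\<exists>r. 0 < r \<and> r \<le> norm x / 2 \<and> (r / norm x) powr \<beta> < measure N' (ball x r))}"
  have "1 \<le> norm x \<and>
      (\<exists>r. 0 < r \<and> r \<le> norm x / 2 \<and> (r / norm x) powr \<beta> < measure N' (ball x r))" if "x \<in> B" for x
    using that by (simp add: B_def)
  then obtain C \<rho> where C: "countable C" "C \<subseteq> B"
    "\<And>x. x \<in> C \<Longrightarrow> 0 < \<rho> x" "B \<subseteq> (\<Union>x\<in>C. ball x (\<rho> x))"
    "(\<lambda>x. (\<rho> x / norm x) powr \<beta>) summable_on C"
    by (rule concentration_cover[OF fin' sets', of B \<beta>]) (assumption | rule that)+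
  define J where "J = to_nat_on C ` C"
  define c where "c = inv_into C (to_nat_on C)"
  have inj: "inj_on (to_nat_on C) C" using C(1) by (rule inj_on_to_nat_on)
  have cJ: "bij_betw c J C"
    unfolding c_def J_def using inj by (intro bij_betw_inv_into inj_on_imp_bij_betw)
  have C_eq: "C = c ` J" using cJ by (simp add: bij_betw_def)
  show thesis
  proof (rule that[of J c "\<rho> \<circ> c"])
    show "c j \<in> S \<and> 0 < (\<rho> \<circ> c) j" if "j \<in> J" for j
      using that C(2,3) C_eq by (auto simp: B_def)
    have "(\<lambda>j. (\<rho> (c j) / norm (c j)) powr \<beta>) summable_on J"
      by (rule summable_on_reindex_bij_betw[OF cJ, THEN iffD2, OF C(5)])
    thus "(\<lambda>j. (\<rho> \<circ> c) j powr \<beta> / norm (c j) powr \<beta>) summable_on J"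
      by (rule summable_on_cong[THEN iffD1, rotated])
        (use C(3) C_eq in \<open>auto simp: powr_divide less_imp_le\<close>)
    fix \<epsilon> :: real assume \<epsilon>: "0 < \<epsilon>"
    obtain K :: nat where K: "1 / \<epsilon> < real K" using reals_Archimedean2 by blast
    have K0: "0 < real K" using K \<epsilon> by (metis less_trans zero_less_divide_1_iff)
    obtain R where R: "\<And>y. R \<le> norm y \<Longrightarrow> of_nat K \<le> w y" using w_inf by blast
    show "\<exists>R. \<forall>x \<in> S - (\<Union>j\<in>J. ball (c j) ((\<rho> \<circ> c) j)). R \<le> norm x \<longrightarrow>
      (\<forall>r. 0 < r \<and> r \<le> norm x / 2 \<longrightarrow> measure N (ball x r) \<le> \<epsilon> * (r / norm x) powr \<beta>)"
    proof (intro exI[of _ "max 1 (2 * R)"] ballI impI allI)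
      fix x r assume x: "x \<in> S - (\<Union>j\<in>J. ball (c j) ((\<rho> \<circ> c) j))" "max 1 (2 * R) \<le> norm x"
        and r: "0 < r \<and> r \<le> norm x / 2"
      have "x \<notin> B" using x(1) C(4) C_eq by auto
      hence le: "measure N' (ball x r) \<le> (r / norm x) powr \<beta>"
        using x r by (auto simp: B_def not_less)
      have "R \<le> norm y" if "y \<in> ball x r" for y
        using that r x(2) norm_triangle_ineq2[of x y] by (simp add: dist_norm)
      hence "of_nat K * emeasure N (ball x r) \<le> (\<integral>\<^sup>+y. w y * indicator (ball x r) y \<partial>N)"
        using R by (subst nn_integral_cmult_indicator[symmetric])
          (auto intro!: nn_integral_mono simp: indicator_def)
      also have "\<dots> = emeasure N' (ball x r)" by (simp add: N'_def emeasure_density)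
      finally have "real K * measure N (ball x r) \<le> measure N' (ball x r)"
        by (simp add: emeasure_eq_measure finite_measure.emeasure_eq_measure[OF fin']
          ennreal_of_nat_eq_real_of_nat ennreal_mult'[symmetric])
      hence "measure N (ball x r) \<le> (1 / real K) * (r / norm x) powr \<beta>"
        using le K0 by (simp add: field_simps)
      also have "\<dots> \<le> \<epsilon> * (r / norm x) powr \<beta>"
        using K K0 \<epsilon> by (intro mult_right_mono) (auto simp: field_simps)
      finally show "measure N (ball x r) \<le> \<epsilon> * (r / norm x) powr \<beta>" .
    qed
  qed
qed

section \<open>Potentials off the exceptional balls\<close>

text \<open>
  The function $w/(1+w)$ is bounded, and its increment from \<open>w\<close> to \<open>a w\<close> is comparable to
  $\min(w,1/w)$. The sum telescopes, with a bound that does not depend on where the geometric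
  sequence crosses 1.
\<close>

lemma sum_min_ratio_le:
  fixes a z :: real
  assumes a: "1 < a" and z: "0 < z"
  shows "(\<Sum>k<K. min (z * a ^ k) (1 / (z * a ^ k))) \<le> 4 * a / (a - 1)"
proof -
  define F where "F w = w / (1 + w)" for w :: real
  have step: "min w (1 / w) \<le> 4 * a / (a - 1) * (F (a * w) - F w)" if w: "0 < w" for w
  proof -
    have aw: "0 < 1 + a * w" "0 < 1 + w" using w a by (auto intro: add_pos_pos)
    have "min w (1 / w) * (1 + w)\<^sup>2 \<le> 4 * w"
    proof (cases "w \<le> 1")
      case True
      have "(1 + w)\<^sup>2 \<le> 2\<^sup>2" using True w by (intro power_mono) auto
      moreover have "w \<le> 1 / w" using True w by (simp add: divide_simps mult_le_one)
      ultimately show ?thesis using w by (simp add: min_def mult.commute)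
    next
      case False
      have "(1 + w)\<^sup>2 \<le> (2 * w)\<^sup>2" using False by (intro power_mono) auto
      moreover have "1 / w \<le> w" using False by (simp add: divide_simps less_1_mult less_imp_le)
      ultimately show ?thesis using w by (simp add: min_def divide_simps power2_eq_square)
    qed
    hence "min w (1 / w) \<le> 4 * w / (1 + w)\<^sup>2" using aw by (simp add: pos_le_divide_eq)
    also have "\<dots> \<le> 4 * w * a / ((1 + a * w) * (1 + w))"
    proof -
      have "1 + a * w \<le> a * (1 + w)" using a by (simp add: algebra_simps)
      hence "(1 + a * w) * (1 + w) \<le> a * (1 + w) * (1 + w)" using w by (intro mult_right_mono) auto
      hence "4 * w * a / (a * (1 + w) * (1 + w)) \<le> 4 * w * a / ((1 + a * w) * (1 + w))"
        using aw w a by (intro divide_left_mono mult_pos_pos) auto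
      thus ?thesis using a by (simp add: power2_eq_square mult.assoc)
    qed
    also have "\<dots> = 4 * a / (a - 1) * (F (a * w) - F w)"
    proof -
      have "F (a * w) - F w = (a - 1) * w / ((1 + a * w) * (1 + w))"
        unfolding F_def using aw by (subst diff_frac_eq) (auto simp: algebra_simps)
      thus ?thesis using a by simp
    qed
    finally show ?thesis .
  qed
  have F: "0 \<le> F w" "F w \<le> 1" if "0 < w" for w using that by (auto simp: F_def)
  have pos: "0 < z * a ^ k" for k using a z by simp
  have "(\<Sum>k<K. min (z * a ^ k) (1 / (z * a ^ k))) \<le>
      (\<Sum>k<K. 4 * a / (a - 1) * (F (z * a ^ Suc k) - F (z * a ^ k)))"
  proof (rule sum_mono)
    fix k
    have "a * (z * a ^ k) = z * a ^ Suc k" by simp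
    with step[OF pos] show "min (z * a ^ k) (1 / (z * a ^ k)) \<le>
      4 * a / (a - 1) * (F (z * a ^ Suc k) - F (z * a ^ k))" by metis
  qed
  also have "\<dots> = 4 * a / (a - 1) * (F (z * a ^ K) - F (z * a ^ 0))"
    unfolding sum_distrib_left[symmetric]
    by (simp only: sum_lessThan_telescope[of "\<lambda>k. F (z * a ^ k)" K])
  also have "\<dots> \<le> 4 * a / (a - 1) * 1"
    using F[OF pos, of K] F[OF pos, of 0] a by (intro mult_left_mono) auto
  finally show ?thesis by simp
qed

text \<open>
  With $q = x_n/r$ this is the contribution of the shell of radius \<open>r\<close>: $\alpha > 0$ makes it decay for
  the shells larger than $x_n$, and $\alpha < 2$ for the smaller ones.
\<close>

lemma min_powr_ratio:
  fixes q :: real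
  assumes q: "0 < q" and \<alpha>: "0 < \<alpha>" "\<alpha> < 2"
  shows "q powr \<alpha> / (max q 1)\<^sup>2 \<le> min (q powr min \<alpha> (2 - \<alpha>)) (1 / q powr min \<alpha> (2 - \<alpha>))"
proof (cases "q \<le> 1")
  case True
  have "q powr \<alpha> \<le> q powr min \<alpha> (2 - \<alpha>)" using True q by (intro powr_mono') auto
  moreover have "q powr min \<alpha> (2 - \<alpha>) \<le> 1" using True q \<alpha> by (intro powr_le1) auto
  moreover from this have "1 \<le> 1 / q powr min \<alpha> (2 - \<alpha>)" using q by (simp add: divide_simps)
  ultimately show ?thesis using True by (simp add: max_def)
next
  case False
  have "q powr \<alpha> / (max q 1)\<^sup>2 = q powr (- (2 - \<alpha>))"
    using False q by (simp add: max_def powr_diff powr_minus_divide)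
  also have "\<dots> \<le> q powr (- min \<alpha> (2 - \<alpha>))" using False by (intro powr_mono) auto
  also have "\<dots> = 1 / q powr min \<alpha> (2 - \<alpha>)" by (simp add: powr_minus_divide)
  finally have "q powr \<alpha> / (max q 1)\<^sup>2 \<le> 1 / q powr min \<alpha> (2 - \<alpha>)" .
  moreover have "1 \<le> q powr min \<alpha> (2 - \<alpha>)" using False \<alpha> by (intro ge_one_powr_ge_zero) auto
  moreover from this have "1 / q powr min \<alpha> (2 - \<alpha>) \<le> 1" by (simp add: divide_simps)
  ultimately show ?thesis by simp
qed

lemma dyadic_shell:
  fixes d R :: real
  assumes "0 < d" "d < R"
  obtains k where "R * (1/2) ^ Suc k \<le> d" "d < R * (1/2) ^ k"
proof -
  obtain k where "(1/2 :: real) ^ k < d / R" using real_arch_pow_inv[of "d / R" "1/2"] assms by auto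
  hence "R * (1/2) ^ k < d" using assms by (simp add: pos_less_divide_eq mult.commute)
  moreover have "R * (1/2) ^ Suc k \<le> R * (1/2) ^ k" using assms by simp
  ultimately have ex: "\<exists>k. R * (1/2) ^ Suc k \<le> d" by (intro exI[of _ k]) linarith
  define k0 where "k0 = (LEAST k. R * (1/2) ^ Suc k \<le> d)"
  have "R * (1/2) ^ Suc k0 \<le> d" unfolding k0_def using ex by (rule LeastI_ex)
  moreover have "d < R * (1/2) ^ k0"
  proof (cases k0)
    case (Suc j)
    hence "\<not> R * (1/2) ^ Suc j \<le> d" using not_less_Least[of j "\<lambda>k. R * (1/2) ^ Suc k \<le> d"] by (simp add: k0_def)
    thus ?thesis using Suc by simp
  qed (use assms in simp)
  ultimately show thesis by (rule that)
qed

lemma riesz_majorant_measurable: "riesz_majorant n x \<in> borel_measurable borel"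
proof -
  have [measurable]: "(\<lambda>y. norm (x - y)) \<in> borel_measurable borel"
    by (intro borel_measurable_continuous_onI continuous_intros)
  show ?thesis unfolding riesz_majorant_def[abs_def] by measurable
qed

text \<open>
  The factor $2^n$ compares the majorant on a shell with its value at the outer radius; the rest is
  the bound of the telescoping sum for the ratio $2^{\min(\alpha,2-\alpha)}$.
\<close>

definition dyadic_const :: "nat \<Rightarrow> real \<Rightarrow> real" where
  "dyadic_const n \<alpha> = 2 ^ n * (4 * 2 powr min \<alpha> (2 - \<alpha>) / (2 powr min \<alpha> (2 - \<alpha>) - 1))"

lemma dyadic_const_nonneg: "0 < \<alpha> \<Longrightarrow> \<alpha> < 2 \<Longrightarrow> 0 \<le> dyadic_const n \<alpha>"
  unfolding dyadic_const_def
  by (intro mult_nonneg_nonneg divide_nonneg_nonneg) (auto intro: ge_one_powr_ge_zero)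

text \<open>
  The ball is cut into the shells between the radii $r_k = 2^{-k-1}|x|$. On a shell the majorant is
  essentially constant and the mass is controlled by the hypothesis; with $q_k = x_n/r_k$ the
  shell contributes $\epsilon q_k^\alpha/\max(q_k,1)^2$, and the $q_k$ form a geometric sequence.
\<close>

lemma near_potential_bound:
  fixes N :: "'d::finite point measure" and x :: "'d point"
  assumes fin: "finite_measure N" and sets: "sets N = sets borel"
    and n: "3 \<le> n" and \<alpha>: "0 < \<alpha>" "\<alpha> < 2" and x: "0 < snd x" and \<epsilon>: "0 \<le> \<epsilon>"
    and ball: "\<And>r. 0 < r \<Longrightarrow> r \<le> norm x / 2 \<Longrightarrow>
      measure N (ball x r) \<le> \<epsilon> * (r / norm x) powr (real n - \<alpha>)"
  shows "(\<integral>\<^sup>+y. ennreal (snd x powr \<alpha> * norm x powr (real n - \<alpha>) * riesz_majorant n x y *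
      indicator (ball x (norm x / 2)) y) \<partial>N) \<le> ennreal (dyadic_const n \<alpha> * \<epsilon>)"
proof -
  interpret finite_measure N by fact
  define h s where "h = snd x" and "s = norm x"
  have h: "0 < h" using x by (simp add: h_def)
  have s: "0 < s" using x by (auto simp: s_def)
  define r where "r k = s / 2 * (1/2) ^ k" for k :: nat
  have r: "0 < r k" "r k \<le> s / 2" "r (Suc k) = r k / 2" for k
    using s by (auto simp: r_def mult_le_cancel_left1 power_le_one)
  define M where "M = h powr \<alpha> * s powr (real n - \<alpha>)"
  have M: "0 \<le> M" by (simp add: M_def)
  define b where "b k = M * (2 ^ n / (r k ^ (n - 2) * (max h (r k))\<^sup>2))" for k
  have b: "0 \<le> b k" for k using M r[of k] by (simp add: b_def)
  define \<delta> where "\<delta> = min \<alpha> (2 - \<alpha>)"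
  define a where "a = 2 powr \<delta>"
  have a: "1 < a" using \<alpha> by (simp add: a_def \<delta>_def)
  define z where "z = (h / (s / 2)) powr \<delta>"
  have z: "0 < z" using h s by (simp add: z_def)
  have zk: "(h / r k) powr \<delta> = z * a ^ k" for k
  proof -
    have "h / r k = h / (s / 2) * 2 ^ k" by (simp add: r_def power_divide)
    hence "(h / r k) powr \<delta> = (h / (s / 2)) powr \<delta> * (2 ^ k) powr \<delta>"
      using h s by (simp only: powr_mult divide_nonneg_pos zero_le_power less_imp_le half_gt_zero zero_le_numeral)
    moreover have "(2 ^ k :: real) powr \<delta> = a ^ k"
      by (simp add: a_def powr_realpow[symmetric] powr_powr mult.commute powr_power)
    ultimately show ?thesis by (simp only: z_def)
  qed
  have b_ball: "b k * measure N (ball x (r k)) \<le> 2 ^ n * \<epsilon> * min (z * a ^ k) (1 / (z * a ^ k))" for k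
  proof -
    define q where "q = h / r k"
    have q: "0 < q" "h = q * r k" using h r[of k] by (auto simp: q_def)
    have "b k * measure N (ball x (r k)) \<le> b k * (\<epsilon> * (r k / s) powr (real n - \<alpha>))"
      using ball[of "r k"] r b by (intro mult_left_mono) (auto simp: s_def)
    also have "\<dots> = 2 ^ n * \<epsilon> * (q powr \<alpha> / (max q 1)\<^sup>2)"
    proof -
      have "max h (r k) = r k * max q 1" using q r[of k] by (simp add: max_def mult.commute)
      hence "r k ^ (n - 2) * (max h (r k))\<^sup>2 = r k ^ n * (max q 1)\<^sup>2"
        using n power_diff_two_mult[of n "r k"] by (simp add: power_mult_distrib)
      moreover have "r k ^ n = r k powr (real n - \<alpha>) * r k powr \<alpha>"
        using r(1)[of k] by (simp add: powr_add[symmetric] powr_realpow)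
      moreover have "h powr \<alpha> = q powr \<alpha> * r k powr \<alpha>"
        using q r(1)[of k] by (simp add: powr_mult)
      moreover have "(r k / s) powr (real n - \<alpha>) = r k powr (real n - \<alpha>) / s powr (real n - \<alpha>)"
        using r(1)[of k] s by (simp add: powr_divide)
      moreover have "0 < r k powr (real n - \<alpha>)" "0 < r k powr \<alpha>" "0 < s powr (real n - \<alpha>)"
        using r(1)[of k] s by auto
      ultimately show ?thesis unfolding b_def M_def by simp
    qed
    also have "\<dots> \<le> 2 ^ n * \<epsilon> * min (q powr \<delta>) (1 / q powr \<delta>)"
      unfolding \<delta>_def using q \<alpha> \<epsilon> by (intro mult_left_mono min_powr_ratio) auto
    finally show ?thesis unfolding q_def zk .
  qed
  have pointwise: "ennreal (M * riesz_majorant n x y * indicator (ball x (s / 2)) y) \<le>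
      (\<Sum>k. ennreal (b k) * indicator (ball x (r k)) y)" for y
  proof (cases "y \<in> ball x (s / 2) \<and> y \<noteq> x")
    case False
    \<comment> \<open>at \<open>y = x\<close> the majorant takes the default value 0 of a division by 0\<close>
    hence "M * riesz_majorant n x y * indicator (ball x (s / 2)) y = 0"
      using n by (auto simp: riesz_majorant_def)
    thus ?thesis by (simp only: ennreal_0 zero_le)
  next
    case True
    define d where "d = norm (x - y)"
    have d: "0 < d" "d < s / 2" using True by (auto simp: d_def dist_norm)
    then obtain k where k: "r (Suc k) \<le> d" "d < r k" unfolding r_def by (rule dyadic_shell)
    have "(r k / 2) ^ (n - 2) * (max h (r k) / 2)\<^sup>2 \<le> d ^ (n - 2) * (max h d)\<^sup>2"
      using k r[of k] h by (intro mult_mono power_mono) (auto simp: max_def)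
    moreover have "(r k / 2) ^ (n - 2) * (max h (r k) / 2)\<^sup>2 = r k ^ (n - 2) * (max h (r k))\<^sup>2 / 2 ^ n"
    proof -
      have "(r k / 2) ^ (n - 2) * (max h (r k) / 2)\<^sup>2 =
          r k ^ (n - 2) * (max h (r k))\<^sup>2 / (2 ^ (n - 2) * 2\<^sup>2)"
        unfolding power_divide by simp
      thus ?thesis using n power_diff_two_mult[of n 2] by simp
    qed
    moreover have "0 < r k ^ (n - 2) * (max h (r k))\<^sup>2 / 2 ^ n"
      using r(1)[of k] by (intro divide_pos_pos mult_pos_pos) auto
    ultimately have "1 / (d ^ (n - 2) * (max h d)\<^sup>2) \<le> 1 / (r k ^ (n - 2) * (max h (r k))\<^sup>2 / 2 ^ n)"
      by (intro frac_le) auto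
    hence "riesz_majorant n x y \<le> 2 ^ n / (r k ^ (n - 2) * (max h (r k))\<^sup>2)"
      unfolding riesz_majorant_def d_def[symmetric] h_def[symmetric] by simp
    hence "M * riesz_majorant n x y \<le> b k"
      unfolding b_def using M by (intro mult_left_mono)
    hence "M * riesz_majorant n x y * indicator (ball x (s / 2)) y \<le> b k" using True by simp
    hence "ennreal (M * riesz_majorant n x y * indicator (ball x (s / 2)) y) \<le>
        ennreal (b k) * indicator (ball x (r k)) y"
      using k by (simp add: d_def dist_norm ennreal_leI)
    also have "\<dots> = (\<Sum>i\<in>{k}. ennreal (b i) * indicator (ball x (r i)) y)"
      by (simp only: sum.insert finite.emptyI empty_iff not_False_eq_True sum.empty add_0_right)
    also have "\<dots> \<le> (\<Sum>k. ennreal (b k) * indicator (ball x (r k)) y)"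
      by (intro sum_le_suminf) auto
    finally show ?thesis .
  qed
  have [measurable]: "ball x (r k) \<in> sets borel" for k by simp
  have meas: "(\<lambda>y. ennreal (b k) * indicator (ball x (r k)) y) \<in> borel_measurable N" for k
    unfolding measurable_cong_sets[OF sets refl] by measurable
  have "(\<integral>\<^sup>+y. ennreal (M * riesz_majorant n x y * indicator (ball x (s / 2)) y) \<partial>N) \<le>
      (\<integral>\<^sup>+y. (\<Sum>k. ennreal (b k) * indicator (ball x (r k)) y) \<partial>N)"
    by (intro nn_integral_mono pointwise)
  also have "\<dots> = (\<Sum>k. ennreal (b k * measure N (ball x (r k))))"
    using b by (subst nn_integral_suminf[OF meas])
      (simp add: sets nn_integral_cmult_indicator emeasure_eq_measure ennreal_mult')
  also have "\<dots> \<le> (\<Sum>k. ennreal (2 ^ n * \<epsilon> * min (z * a ^ k) (1 / (z * a ^ k))))"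
    by (intro suminf_le ennreal_leI b_ball) auto
  also have "\<dots> \<le> ennreal (dyadic_const n \<alpha> * \<epsilon>)"
    unfolding suminf_eq_SUP
  proof (rule SUP_least)
    fix K :: nat
    have pos: "0 \<le> min (z * a ^ k) (1 / (z * a ^ k))" for k using a z by simp
    have "(\<Sum>k<K. 2 ^ n * \<epsilon> * min (z * a ^ k) (1 / (z * a ^ k))) \<le> 2 ^ n * \<epsilon> * (4 * a / (a - 1))"
      unfolding sum_distrib_left[symmetric] using \<epsilon> a z by (intro mult_left_mono sum_min_ratio_le) auto
    also have "\<dots> = dyadic_const n \<alpha> * \<epsilon>" by (simp add: dyadic_const_def a_def \<delta>_def)
    finally have "ennreal (\<Sum>k<K. 2 ^ n * \<epsilon> * min (z * a ^ k) (1 / (z * a ^ k))) \<le> ennreal (dyadic_const n \<alpha> * \<epsilon>)"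
      by (rule ennreal_leI)
    thus "(\<Sum>k<K. ennreal (2 ^ n * \<epsilon> * min (z * a ^ k) (1 / (z * a ^ k)))) \<le> ennreal (dyadic_const n \<alpha> * \<epsilon>)"
      using \<epsilon> pos by (subst sum_ennreal) (auto intro!: mult_nonneg_nonneg)
  qed
  finally show ?thesis by (simp only: M_def h_def s_def)
qed

text \<open>
  All but a small part of the mass lies in a fixed ball, where the integrand is at most a constant
  divided by \<open>t\<close>.
\<close>

lemma far_potential_small:
  fixes N :: "'a::euclidean_space measure"
  assumes fin: "finite_measure N" and sets: "sets N = sets borel" and \<epsilon>: "0 < \<epsilon>"
  shows "\<exists>R. \<forall>t\<ge>R. (\<integral>\<^sup>+y. ennreal (min 1 ((1 + norm y) / t)) \<partial>N) \<le> ennreal \<epsilon>"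
proof -
  interpret finite_measure N by fact
  obtain R where R: "measure N {y. R \<le> norm y} < \<epsilon> / 2"
    using finite_measure_tail[OF fin sets, of "\<epsilon> / 2"] \<epsilon> by auto
  have tail: "{y. R \<le> norm y} \<in> sets N"
    unfolding sets by (intro borel_closed closed_Collect_le continuous_intros)
  define L where "L = (1 + \<bar>R\<bar>) * measure N (space N)"
  have L: "0 \<le> L" by (simp add: L_def)
  show ?thesis
  proof (intro exI allI impI)
    fix t assume t: "1 + 2 * L / \<epsilon> \<le> t"
    have t0: "1 \<le> t" "2 * L / \<epsilon> \<le> t" using t L \<epsilon> by (auto intro: order_trans[rotated])
    hence "2 * L \<le> t * \<epsilon>" using \<epsilon> by (simp add: pos_divide_le_eq)
    hence Lt: "L / t \<le> \<epsilon> / 2" using t0 by (simp add: divide_simps mult.commute)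
    have "(\<integral>\<^sup>+y. ennreal (min 1 ((1 + norm y) / t)) \<partial>N) \<le>
        (\<integral>\<^sup>+y. ennreal ((1 + \<bar>R\<bar>) / t) + indicator {y. R \<le> norm y} y \<partial>N)"
    proof (rule nn_integral_mono)
      fix y :: 'a
      show "ennreal (min 1 ((1 + norm y) / t)) \<le> ennreal ((1 + \<bar>R\<bar>) / t) + indicator {y. R \<le> norm y} y"
      proof (cases "R \<le> norm y")
        case True
        have "ennreal (min 1 ((1 + norm y) / t)) \<le> ennreal 1" by (intro ennreal_leI) simp
        thus ?thesis using True by (simp add: add_increasing)
      next
        case False
        have "min 1 ((1 + norm y) / t) \<le> (1 + \<bar>R\<bar>) / t"
          using False t0 by (intro min.coboundedI2 divide_right_mono) auto
        thus ?thesis using False by (simp add: ennreal_leI)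
      qed
    qed
    also have "\<dots> = ennreal ((1 + \<bar>R\<bar>) / t) * emeasure N (space N) + emeasure N {y. R \<le> norm y}"
      using tail by (subst nn_integral_add) auto
    also have "\<dots> = ennreal (L / t + measure N {y. R \<le> norm y})"
      using t0 by (simp add: emeasure_eq_measure L_def ennreal_mult'[symmetric] ennreal_plus[symmetric] del: ennreal_plus)
    also have "\<dots> \<le> ennreal \<epsilon>" using R Lt by (intro ennreal_leI) linarith
    finally show "(\<integral>\<^sup>+y. ennreal (min 1 ((1 + norm y) / t)) \<partial>N) \<le> ennreal \<epsilon>" .
  qed
qed

text \<open>
  The target $x_n^{1-\alpha}|x|^{m+\alpha}$ dominates the far part $x_n|x|^m$ because $x_n \le |x|$ and
  $\alpha > 0$, and is exactly what remains of the near part once the dyadic estimate is factored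
  out. No point off the balls carries mass, since the mass of small balls tends to 0 with the radius;
  this excludes the pole of the Green function.
\<close>

lemma potential_small:
  fixes N :: "'d::finite point measure" and S :: "'d point set"
  assumes fin: "finite_measure N" and sets: "sets N = sets borel"
    and n: "3 \<le> n" and \<alpha>: "0 < \<alpha>" "\<alpha> < 2" and S: "S \<subseteq> half_space"
    and ball: "\<And>\<epsilon>. 0 < \<epsilon> \<Longrightarrow> \<exists>R. \<forall>x\<in>S. R \<le> norm x \<longrightarrow>
      (\<forall>r. 0 < r \<and> r \<le> norm x / 2 \<longrightarrow> measure N (ball x r) \<le> \<epsilon> * (r / norm x) powr (real n - \<alpha>))"
    and \<epsilon>: "0 < \<epsilon>"
  shows "\<exists>R. \<forall>x\<in>S. R \<le> norm x \<longrightarrow> emeasure N {x} = 0 \<and>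
    (\<integral>\<^sup>+y. ennreal (snd x * potential_majorant n m x y) \<partial>N) \<le>
      ennreal (\<epsilon> * (snd x powr (1 - \<alpha>) * norm x powr (real m + \<alpha>)))"
proof -
  interpret finite_measure N by fact
  obtain R1 where R1: "\<And>t. R1 \<le> t \<Longrightarrow>
      (\<integral>\<^sup>+y. ennreal (min 1 ((1 + norm y) / t)) \<partial>N) \<le> ennreal (\<epsilon> / 2)"
    using far_potential_small[OF fin sets, of "\<epsilon> / 2"] \<epsilon> by auto
  define \<eta> where "\<eta> = \<epsilon> / (2 * (dyadic_const n \<alpha> + 1))"
  have dc: "0 \<le> dyadic_const n \<alpha>" using \<alpha> by (rule dyadic_const_nonneg)
  have \<eta>: "0 < \<eta>" "dyadic_const n \<alpha> * \<eta> \<le> \<epsilon> / 2"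
    using dc \<epsilon> by (auto simp: \<eta>_def divide_simps)
  obtain R2 where R2: "\<And>x r. x \<in> S \<Longrightarrow> R2 \<le> norm x \<Longrightarrow> 0 < r \<Longrightarrow> r \<le> norm x / 2 \<Longrightarrow>
      measure N (ball x r) \<le> \<eta> * (r / norm x) powr (real n - \<alpha>)"
    using ball[OF \<eta>(1)] by metis
  show ?thesis
  proof (intro exI ballI impI conjI)
    fix x assume xS: "x \<in> S" and "max R1 R2 \<le> norm x"
    hence xR: "R1 \<le> norm x" "R2 \<le> norm x" by auto
    define h s where "h = snd x" and "s = norm x"
    have h: "0 < h" using xS S by (auto simp: h_def half_space_def)
    have hs: "h \<le> s" by (simp add: h_def s_def snd_le_norm)
    hence s: "0 < s" using h by simp
    have n\<alpha>: "0 < real n - \<alpha>" using n \<alpha> by simp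
    show "emeasure N {x} = 0"
    proof -
      have le: "measure N {x} \<le> \<eta> * t powr (real n - \<alpha>)" if t: "0 < t" "t \<le> 1/2" for t
      proof -
        have "measure N {x} \<le> measure N (ball x (t * s))"
          using t s by (intro finite_measure_mono) (auto simp: sets)
        also have "\<dots> \<le> \<eta> * (t * s / norm x) powr (real n - \<alpha>)"
          using t s by (intro R2 xS xR) (auto simp: s_def)
        finally show ?thesis using s by (simp add: s_def)
      qed
      have "((\<lambda>t. \<eta> * t powr (real n - \<alpha>)) \<longlongrightarrow> \<eta> * 0 powr (real n - \<alpha>)) (at_right 0)"
        using n\<alpha> by (intro tendsto_mult tendsto_const tendsto_powr' tendsto_ident_at)
          (auto simp: eventually_at_filter)
      moreover have "eventually (\<lambda>t. measure N {x} \<le> \<eta> * t powr (real n - \<alpha>)) (at_right 0)"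
        unfolding eventually_at_right_field by (intro exI[of _ "1/2"]) (auto intro: le)
      ultimately have "measure N {x} \<le> \<eta> * 0 powr (real n - \<alpha>)"
        by (intro tendsto_lowerbound) auto
      thus ?thesis by (simp add: emeasure_eq_measure measure_le_0_iff)
    qed
    define T where "T = h powr (1 - \<alpha>) * s powr (real m + \<alpha>)"
    have T: "0 < T" using h s by (simp add: T_def)
    define near where "near y = h powr \<alpha> * s powr (real n - \<alpha>) * riesz_majorant n x y *
      indicator (ball x (s / 2)) y" for y
    have near: "0 \<le> near y" for y by (simp add: near_def riesz_majorant_nonneg)
    \<comment> \<open>\<open>h = h powr (1 - \<alpha>) * h powr \<alpha>\<close>: one factor goes to the target, the other to the integrand\<close>
    have pw: "h * potential_majorant n m x y \<le> T * (min 1 ((1 + norm y) / s) + near y)" for y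
    proof -
      have h1: "h = h powr (1 - \<alpha>) * h powr \<alpha>" using h by (simp flip: powr_add)
      have "h * s ^ m \<le> T"
      proof -
        have "h * s ^ m = h powr (1 - \<alpha>) * h powr \<alpha> * s powr real m"
          using h1 s by (simp add: powr_realpow)
        also have "\<dots> \<le> h powr (1 - \<alpha>) * s powr \<alpha> * s powr real m"
          using h hs \<alpha> by (intro mult_right_mono mult_left_mono powr_mono2) auto
        also have "\<dots> = T" by (simp add: T_def powr_add)
        finally show ?thesis .
      qed
      hence "h * s ^ m * min 1 ((1 + norm y) / s) \<le> T * min 1 ((1 + norm y) / s)"
        using s by (intro mult_right_mono) auto
      moreover have "h * s ^ (n + m) = T * (h powr \<alpha> * s powr (real n - \<alpha>))"
      proof -
        have "s ^ (n + m) = s powr (real m + \<alpha>) * s powr (real n - \<alpha>)"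
          using s by (simp add: powr_add[symmetric] powr_realpow[symmetric] add.commute)
        thus ?thesis by (subst h1) (simp add: T_def)
      qed
      ultimately show ?thesis
        unfolding potential_majorant_def near_def s_def[symmetric]
        by (simp add: distrib_left mult.assoc[symmetric])
    qed
    have meas1: "(\<lambda>y. ennreal (min 1 ((1 + norm y) / s))) \<in> borel_measurable N"
      unfolding measurable_cong_sets[OF sets refl] by measurable
    have meas2: "(\<lambda>y. ennreal (near y)) \<in> borel_measurable N"
      unfolding measurable_cong_sets[OF sets refl] near_def
      by (intro measurable_compose[OF _ measurable_ennreal] borel_measurable_times measurable_const
          borel_measurable_indicator riesz_majorant_measurable) simp_all
    have "(\<integral>\<^sup>+y. ennreal (h * potential_majorant n m x y) \<partial>N) \<le>
        (\<integral>\<^sup>+y. ennreal T * (ennreal (min 1 ((1 + norm y) / s)) + ennreal (near y)) \<partial>N)"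
      using T s near pw
      by (intro nn_integral_mono) (simp add: ennreal_plus[symmetric] ennreal_mult'[symmetric] ennreal_leI del: ennreal_plus)
    also have "\<dots> = ennreal T * ((\<integral>\<^sup>+y. ennreal (min 1 ((1 + norm y) / s)) \<partial>N) + (\<integral>\<^sup>+y. ennreal (near y) \<partial>N))"
      using meas1 meas2 by (subst nn_integral_cmult) (auto simp: nn_integral_add)
    also have "\<dots> \<le> ennreal T * (ennreal (\<epsilon> / 2) + ennreal (\<epsilon> / 2))"
    proof (intro mult_left_mono add_mono)
      show "(\<integral>\<^sup>+y. ennreal (min 1 ((1 + norm y) / s)) \<partial>N) \<le> ennreal (\<epsilon> / 2)"
        using xR by (intro R1) (simp add: s_def)
      have "(\<integral>\<^sup>+y. ennreal (near y) \<partial>N) \<le> ennreal (dyadic_const n \<alpha> * \<eta>)"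
        unfolding near_def h_def s_def using h \<eta> R2[OF xS xR(2)]
        by (intro near_potential_bound fin sets n \<alpha>) (auto simp: h_def)
      also have "\<dots> \<le> ennreal (\<epsilon> / 2)" by (intro ennreal_leI \<eta>)
      finally show "(\<integral>\<^sup>+y. ennreal (near y) \<partial>N) \<le> ennreal (\<epsilon> / 2)" .
    qed auto
    also have "\<dots> = ennreal (\<epsilon> * T)"
      using \<epsilon> T by (simp add: ennreal_plus[symmetric] ennreal_mult'[symmetric] mult.commute del: ennreal_plus)
    finally show "(\<integral>\<^sup>+y. ennreal (snd x * potential_majorant n m x y) \<partial>N) \<le>
        ennreal (\<epsilon> * (snd x powr (1 - \<alpha>) * norm x powr (real m + \<alpha>)))"
      by (simp only: T_def h_def s_def)
  qed
qed

section \<open>Growth of the modified potentials\<close>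

text \<open>
  Boundary data and interior mass are to be controlled by the same balls; for this their sum as
  measures is covered.
\<close>

lemma sum_of_finite_measures:
  fixes N1 N2 :: "'a::topological_space measure"
  assumes fin: "finite_measure N1" "finite_measure N2"
    and sets: "sets N1 = sets borel" "sets N2 = sets borel"
  obtains N where "finite_measure N" "sets N = sets borel"
    "\<And>A. A \<in> sets borel \<Longrightarrow> emeasure N A = emeasure N1 A + emeasure N2 A"
proof -
  define N :: "'a measure" where "N = measure_of UNIV (sets borel) (\<lambda>A. emeasure N1 A + emeasure N2 A)"
  have sets_N: "sets N = sets borel"
    unfolding N_def using sets.sigma_sets_eq[of "borel :: 'a measure"] by (simp add: sets_measure_of)
  have em: "emeasure N A = emeasure N1 A + emeasure N2 A" if "A \<in> sets borel" for A
  proof (rule emeasure_measure_of[OF N_def])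
    show "countably_additive (sets N) (\<lambda>A. emeasure N1 A + emeasure N2 A)"
      unfolding countably_additive_def sets_N
    proof (intro allI impI)
      fix A :: "nat \<Rightarrow> 'a set"
      assume A: "range A \<subseteq> sets borel" "disjoint_family A"
      thus "(\<Sum>i. emeasure N1 (A i) + emeasure N2 (A i)) =
          emeasure N1 (\<Union>i. A i) + emeasure N2 (\<Union>i. A i)"
        using suminf_emeasure[of A N1] suminf_emeasure[of A N2]
        by (simp add: sets suminf_add[symmetric])
    qed
  qed (use that in \<open>auto simp: positive_def sets_N\<close>)
  have space: "space N1 = UNIV" "space N2 = UNIV" "space N = UNIV"
    using sets_eq_imp_space_eq[OF sets(1)] sets_eq_imp_space_eq[OF sets(2)]
      sets_eq_imp_space_eq[OF sets_N] by auto
  have "emeasure N (space N) = emeasure N1 (space N1) + emeasure N2 (space N2)"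
    unfolding space by (rule em) simp
  also have "\<dots> < \<infinity>"
    using finite_measure.emeasure_finite[OF fin(1)] finite_measure.emeasure_finite[OF fin(2)]
    by (simp add: less_top)
  finally have "finite_measure N" by (intro finite_measureI) auto
  thus thesis using that sets_N em by blast
qed

lemma abs_integral_le_nn_integral: "ennreal \<bar>\<integral>y. g y \<partial>M\<bar> \<le> (\<integral>\<^sup>+y. ennreal \<bar>g y\<bar> \<partial>M)"
  for g :: "'a \<Rightarrow> real"
proof (cases "integrable M g")
  case True
  thus ?thesis using integral_norm_bound_ennreal[of M g] by simp
qed (simp add: not_integrable_integral_eq)

lemma abs_ereal_integral_le:
  assumes B: "0 \<le> B" and b: "(\<integral>\<^sup>+y. ennreal (b y) \<partial>M) \<le> ennreal B"
    and g: "AE y in M. \<exists>r. g y = ereal r \<and> \<bar>r\<bar> \<le> b y"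
  obtains r where "ereal_integral M g = ereal r" "\<bar>r\<bar> \<le> B"
proof -
  have le: "(\<integral>\<^sup>+y. e2ennreal (g y) \<partial>M) \<le> ennreal B" "(\<integral>\<^sup>+y. e2ennreal (- g y) \<partial>M) \<le> ennreal B"
    by (rule order_trans[OF nn_integral_mono_AE b]; use g in eventually_elim;
        auto simp: e2ennreal_ereal intro!: ennreal_leI)+
  obtain p where p: "(\<integral>\<^sup>+y. e2ennreal (g y) \<partial>M) = ennreal p" "0 \<le> p" "p \<le> B"
    using le(1) B by (cases "\<integral>\<^sup>+y. e2ennreal (g y) \<partial>M") (auto simp: top_unique)
  obtain q where q: "(\<integral>\<^sup>+y. e2ennreal (- g y) \<partial>M) = ennreal q" "0 \<le> q" "q \<le> B"
    using le(2) B by (cases "\<integral>\<^sup>+y. e2ennreal (- g y) \<partial>M") (auto simp: top_unique)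
  have "ereal_integral M g = ereal (p - q)"
    unfolding ereal_integral_def p(1) q(1) using p q by (simp add: enn2ereal_ennreal)
  moreover have "\<bar>p - q\<bar> \<le> B" using p q by (simp add: abs_le_iff)
  ultimately show thesis by (rule that)
qed

lemma potential_majorant_nonneg: "0 \<le> potential_majorant n m x y"
  unfolding potential_majorant_def
  by (intro add_nonneg_nonneg mult_nonneg_nonneg riesz_majorant_nonneg) auto

lemma potential_majorant_measurable:
  "(\<lambda>y. ennreal (c * potential_majorant n m x y)) \<in> borel_measurable borel"
proof -
  have [measurable]: "ball x (norm x / 2) \<in> sets borel" by simp
  note riesz_majorant_measurable[measurable]
  show ?thesis unfolding potential_majorant_def by measurable
qed

text \<open>
  Multiplying and dividing by $1+|y|^{n+m}$ turns the bound of the kernel into one by the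
  potential of the finite weighted measure.
\<close>

lemma dominated_integrand:
  assumes "dominated_kernel n m C x y K" "2 \<le> n" "0 \<le> C" "0 < snd x" "2 \<le> norm x" "0 \<le> w"
  shows "K * w \<le> C * (2 * 6 ^ (n + m) + 2 * real m * 3 ^ m) *
    (snd x * potential_majorant n m x y) * (w / (1 + norm y ^ (n + m)))"
proof -
  have pos: "0 < 1 + norm y ^ (n + m)" by (intro add_pos_nonneg) auto
  have "K * w = K * (1 + norm y ^ (n + m)) * (w / (1 + norm y ^ (n + m)))" using pos by simp
  also have "\<dots> \<le> C * (2 * 6 ^ (n + m) + 2 * real m * 3 ^ m) * snd x * potential_majorant n m x y *
      (w / (1 + norm y ^ (n + m)))"
    using assms pos by (intro mult_right_mono dominated_kernel_bound divide_nonneg_pos) auto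
  finally show ?thesis by (simp only: mult.assoc)
qed

lemma boundary_weight_measurable:
  fixes f :: "'a::euclidean_space \<Rightarrow> real"
  assumes "f \<in> borel_measurable lebesgue"
  shows "(\<lambda>y. ennreal (\<bar>f y\<bar> / (1 + norm y ^ k))) \<in> borel_measurable lebesgue"
proof -
  have "norm \<in> borel_measurable (lebesgue :: 'a measure)"
    by (intro measurable_completion) simp
  thus ?thesis
    using assms by (intro measurable_compose[OF _ measurable_ennreal] borel_measurable_divide
      borel_measurable_abs borel_measurable_add borel_measurable_power measurable_const) auto
qed

lemma boundary_embedding_measurable:
  "(\<lambda>y :: 'a::euclidean_space. (y, 0 :: real)) \<in> measurable lebesgue borel"
  by (intro measurable_completion) (simp add: borel_measurable_continuous_onI continuous_intros)

lemma interior_weight_measurable: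
  fixes \<mu> :: "'d::finite point measure"
  assumes "sets \<mu> = sets (restrict_space borel half_space)"
  shows "(\<lambda>y. y) \<in> measurable \<mu> borel"
    and "(\<lambda>y. ennreal (snd y / (1 + norm y ^ k))) \<in> borel_measurable \<mu>"
proof -
  show id_meas: "(\<lambda>y. y) \<in> measurable \<mu> borel"
    unfolding measurable_cong_sets[OF assms refl] by (rule measurable_restrict_space1) simp
  have "1 + norm y ^ k \<noteq> 0" for y :: "'d point"
    using zero_le_power[OF norm_ge_zero, of y k] by linarith
  hence "(\<lambda>y :: 'd point. ennreal (snd y / (1 + norm y ^ k))) \<in> borel_measurable borel"
    by (intro measurable_compose[OF _ measurable_ennreal] borel_measurable_continuous_onI continuous_intros) auto
  from measurable_compose[OF id_meas this]
  show "(\<lambda>y. ennreal (snd y / (1 + norm y ^ k))) \<in> borel_measurable \<mu>" .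
qed

lemma finite_weighted_distr:
  assumes "w \<in> borel_measurable M" "e \<in> measurable M borel" "(\<integral>\<^sup>+y. w y \<partial>M) < \<infinity>"
  shows "finite_measure (distr (density M w) borel e)"
proof (rule finite_measure.finite_measure_distr)
  have "emeasure (density M w) (space (density M w)) = (\<integral>\<^sup>+y. w y \<partial>M)"
    unfolding space_density using assms(1) by (subst emeasure_density) (auto intro!: nn_integral_cong)
  thus "finite_measure (density M w)" using assms(3) by (intro finite_measureI) auto
qed (use assms in simp)

text \<open>
  The weighted boundary data are pushed to the hyperplane $x_n = 0$ of the full space, so that the
  estimates for measures on the space apply to them.
\<close>

lemma poisson_integral_bound:
  fixes f :: "real ^ 'd::finite \<Rightarrow> real"
  assumes n: "2 \<le> n" and f: "f \<in> borel_measurable lebesgue"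
  obtains C where "0 \<le> C" "\<And>x. 0 < snd x \<Longrightarrow> 2 \<le> norm x \<Longrightarrow>
    ennreal \<bar>poisson_integral n m f x\<bar> \<le> ennreal C *
      (\<integral>\<^sup>+y. ennreal (snd x * potential_majorant n m x y)
        \<partial>distr (density lebesgue (\<lambda>y. ennreal (\<bar>f y\<bar> / (1 + norm y ^ (n + m))))) borel (\<lambda>y. (y, 0)))"
proof -
  obtain C where C: "0 \<le> C" "\<And>(x :: 'd point) y. 0 < snd x \<Longrightarrow>
      dominated_kernel n m C x (y, 0) \<bar>modified_poisson_kernel n m x y\<bar>"
    using modified_poisson_kernel_dominated[OF n] by metis
  define C' where "C' = C * (2 * 6 ^ (n + m) + 2 * real m * 3 ^ m)"
  have C': "0 \<le> C'" using C by (simp add: C'_def)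
  define w where "w y = \<bar>f y\<bar> / (1 + norm y ^ (n + m))" for y
  have w: "0 \<le> w y" for y by (simp add: w_def)
  have w_meas: "(\<lambda>y. ennreal (w y)) \<in> borel_measurable lebesgue"
    unfolding w_def using f by (rule boundary_weight_measurable)
  note emb' = boundary_embedding_measurable[where 'a = "real ^ 'd"]
  have emb: "(\<lambda>y :: real^'d. (y, 0 :: real)) \<in> measurable (density lebesgue (\<lambda>y. ennreal (w y))) borel"
    using emb' by simp
  have "ennreal \<bar>poisson_integral n m f x\<bar> \<le> ennreal C' *
      (\<integral>\<^sup>+y. ennreal (snd x * potential_majorant n m x y)
        \<partial>distr (density lebesgue (\<lambda>y. ennreal (w y))) borel (\<lambda>y. (y, 0)))"
    if x: "0 < snd x" "2 \<le> norm x" for x :: "'d point"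
  proof -
    let ?p = "\<lambda>y :: real^'d. ennreal (snd x * potential_majorant n m x (y, 0))"
    have p_meas: "?p \<in> borel_measurable lebesgue"
      by (rule measurable_compose[OF emb' potential_majorant_measurable])
    have "ennreal \<bar>poisson_integral n m f x\<bar> \<le> (\<integral>\<^sup>+y. ennreal \<bar>modified_poisson_kernel n m x y * f y\<bar> \<partial>lebesgue)"
      unfolding poisson_integral_def by (rule abs_integral_le_nn_integral)
    also have "\<dots> \<le> (\<integral>\<^sup>+y. ennreal C' * (ennreal (w y) * ?p y) \<partial>lebesgue)"
    proof (rule nn_integral_mono)
      fix y :: "real^'d"
      have "\<bar>modified_poisson_kernel n m x y * f y\<bar> \<le>
          C' * (snd x * potential_majorant n m x (y, 0)) * (\<bar>f y\<bar> / (1 + norm (y, 0 :: real) ^ (n + m)))"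
        unfolding abs_mult C'_def using C x n by (intro dominated_integrand) auto
      also have "\<dots> = C' * (w y * (snd x * potential_majorant n m x (y, 0)))"
        by (simp add: w_def norm_Pair)
      finally have "ennreal \<bar>modified_poisson_kernel n m x y * f y\<bar> \<le>
          ennreal (C' * (w y * (snd x * potential_majorant n m x (y, 0))))"
        by (rule ennreal_leI)
      thus "ennreal \<bar>modified_poisson_kernel n m x y * f y\<bar> \<le> ennreal C' * (ennreal (w y) * ?p y)"
        using C' w by (simp only: ennreal_mult')
    qed
    also have "\<dots> = ennreal C' * (\<integral>\<^sup>+y. ennreal (w y) * ?p y \<partial>lebesgue)"
      using w_meas p_meas by (intro nn_integral_cmult borel_measurable_times_ennreal)
    also have "(\<integral>\<^sup>+y. ennreal (w y) * ?p y \<partial>lebesgue) = (\<integral>\<^sup>+y. ?p y \<partial>density lebesgue (\<lambda>y. ennreal (w y)))"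
      by (rule nn_integral_density[symmetric, OF w_meas p_meas])
    also have "\<dots> = (\<integral>\<^sup>+y. ennreal (snd x * potential_majorant n m x y)
        \<partial>distr (density lebesgue (\<lambda>y. ennreal (w y))) borel (\<lambda>y. (y, 0)))"
      by (subst nn_integral_distr[OF emb]) (simp_all add: potential_majorant_measurable)
    finally show ?thesis .
  qed
  with C' show thesis unfolding w_def by (rule that)
qed

text \<open>
  The modified Green function is infinite only at $y = x$, which by hypothesis is a null set. Bounding its
  absolute value by an integrable function also shows that neither part of the integral is infinite.
\<close>

lemma green_potential_bound:
  fixes \<mu> :: "'d::finite point measure" and n m :: nat
  assumes n: "3 \<le> n" and sets: "sets \<mu> = sets (restrict_space borel half_space)"
  defines "N \<equiv> distr (density \<mu> (\<lambda>y. ennreal (snd y / (1 + norm y ^ (n + m))))) borel (\<lambda>y. y)"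
  obtains C where "0 \<le> C" "\<And>x B. 0 < snd x \<Longrightarrow> 2 \<le> norm x \<Longrightarrow> emeasure N {x} = 0 \<Longrightarrow> 0 \<le> B \<Longrightarrow>
    (\<integral>\<^sup>+y. ennreal (snd x * potential_majorant n m x y) \<partial>N) \<le> ennreal B \<Longrightarrow>
    \<exists>r. green_potential n m \<mu> x = ereal r \<and> \<bar>r\<bar> \<le> C * B"
proof -
  obtain C where C: "0 \<le> C" "\<And>x y :: 'd point. 0 < snd x \<Longrightarrow> 0 < snd y \<Longrightarrow> x \<noteq> y \<Longrightarrow>
    \<exists>g. modified_green n m x y = ereal g \<and> dominated_kernel n m C x y (\<bar>g\<bar> / snd y)"
    using modified_green_dominated[OF n] by metis
  define C' where "C' = C * (2 * 6 ^ (n + m) + 2 * real m * 3 ^ m)"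
  have C': "0 \<le> C'" using C by (simp add: C'_def)
  have space: "space \<mu> = half_space"
    using sets_eq_imp_space_eq[OF sets] by (simp add: space_restrict_space)
  define w where "w y = snd y / (1 + norm y ^ (n + m))" for y :: "'d point"
  have w: "0 < w y" if "y \<in> half_space" for y
    using that by (auto simp: w_def half_space_def intro!: divide_pos_pos add_pos_nonneg)
  have id_meas: "(\<lambda>y. y) \<in> measurable \<mu> borel"
    using sets by (rule interior_weight_measurable)
  have w_meas: "(\<lambda>y. ennreal (w y)) \<in> borel_measurable \<mu>"
    unfolding w_def using sets by (rule interior_weight_measurable)
  have id_meas': "(\<lambda>y. y) \<in> measurable (density \<mu> (\<lambda>y. ennreal (w y))) borel"
    using id_meas by simp
  have N: "N = distr (density \<mu> (\<lambda>y. ennreal (w y))) borel (\<lambda>y. y)" by (simp add: N_def w_def)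
  have "\<exists>r. green_potential n m \<mu> x = ereal r \<and> \<bar>r\<bar> \<le> C' * B"
    if x: "0 < snd x" "2 \<le> norm x" and null: "emeasure N {x} = 0" and B: "0 \<le> B"
      and le: "(\<integral>\<^sup>+y. ennreal (snd x * potential_majorant n m x y) \<partial>N) \<le> ennreal B" for x B
  proof -
    let ?p = "\<lambda>y. snd x * potential_majorant n m x y"
    have p: "0 \<le> ?p y" for y using x potential_majorant_nonneg[of n m x y] by simp
    have p_meas: "(\<lambda>y. ennreal (?p y)) \<in> borel_measurable \<mu>"
      by (rule measurable_compose[OF id_meas potential_majorant_measurable])
    have "AE y in N. y \<noteq> x"
      by (rule AE_I[of _ _ "{x}"]) (use null in \<open>auto simp: N_def\<close>)
    hence "AE y in density \<mu> (\<lambda>y. ennreal (w y)). y \<noteq> x"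
      unfolding N by (subst (asm) AE_distr_iff[OF id_meas']) auto
    hence "AE y in \<mu>. 0 < ennreal (w y) \<longrightarrow> y \<noteq> x"
      by (simp only: AE_density[OF w_meas])
    hence "AE y in \<mu>. \<exists>r. modified_green n m x y = ereal r \<and> \<bar>r\<bar> \<le> C' * (w y * ?p y)"
      using AE_space
    proof eventually_elim
      fix y assume "0 < ennreal (w y) \<longrightarrow> y \<noteq> x" "y \<in> space \<mu>"
      hence y: "y \<in> half_space" "0 < snd y" "x \<noteq> y" using w[of y] by (auto simp: space half_space_def)
      obtain g where g: "modified_green n m x y = ereal g" "dominated_kernel n m C x y (\<bar>g\<bar> / snd y)"
        using C(2)[OF x(1) y(2,3)] by blast
      have "\<bar>g\<bar> / snd y * snd y \<le> C' * ?p y * (snd y / (1 + norm y ^ (n + m)))"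
        unfolding C'_def using g C x n y by (intro dominated_integrand) auto
      hence "\<bar>g\<bar> \<le> C' * (w y * ?p y)" using y by (simp add: w_def mult_ac)
      thus "\<exists>r. modified_green n m x y = ereal r \<and> \<bar>r\<bar> \<le> C' * (w y * ?p y)" using g by blast
    qed
    moreover have "(\<integral>\<^sup>+y. ennreal (C' * (w y * ?p y)) \<partial>\<mu>) \<le> ennreal (C' * B)"
    proof -
      have "(\<integral>\<^sup>+y. ennreal (C' * (w y * ?p y)) \<partial>\<mu>) = (\<integral>\<^sup>+y. ennreal C' * (ennreal (w y) * ennreal (?p y)) \<partial>\<mu>)"
        using C' p w by (intro nn_integral_cong) (simp add: ennreal_mult' ennreal_mult'' space less_imp_le)
      also have "\<dots> = ennreal C' * (\<integral>\<^sup>+y. ennreal (w y) * ennreal (?p y) \<partial>\<mu>)"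
        using w_meas p_meas by (intro nn_integral_cmult borel_measurable_times_ennreal)
      also have "(\<integral>\<^sup>+y. ennreal (w y) * ennreal (?p y) \<partial>\<mu>) = (\<integral>\<^sup>+y. ennreal (?p y) \<partial>density \<mu> (\<lambda>y. ennreal (w y)))"
        by (rule nn_integral_density[symmetric, OF w_meas p_meas])
      also have "\<dots> = (\<integral>\<^sup>+y. ennreal (?p y) \<partial>N)"
        unfolding N by (subst nn_integral_distr[OF id_meas']) (simp_all add: potential_majorant_measurable)
      also have "ennreal C' * \<dots> \<le> ennreal C' * ennreal B" by (intro mult_left_mono le) auto
      finally show ?thesis using C' by (simp only: ennreal_mult')
    qed
    ultimately obtain r where "ereal_integral \<mu> (modified_green n m x) = ereal r" "\<bar>r\<bar> \<le> C' * B"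
      using B C' by (elim abs_ereal_integral_le[rotated]) auto
    thus ?thesis by (auto simp: green_potential_def)
  qed
  with C' show thesis by (rule that)
qed

theorem theorem2:
  fixes n m :: nat and \<alpha> :: real
    and f :: "real ^ 'd::finite \<Rightarrow> real"
    and \<mu> :: "((real ^ 'd) \<times> real) measure"
    and u :: "(real ^ 'd) \<times> real \<Rightarrow> ereal"
  assumes "n = CARD('d) + 1" and "n \<ge> 3"
    and "f \<in> borel_measurable lebesgue"
    and "(\<integral>\<^sup>+ y. ennreal (\<bar>f y\<bar> / (1 + norm y ^ (n + m))) \<partial>lebesgue) < \<infinity>"
    and "sets \<mu> = sets (restrict_space borel half_space)"
    and "(\<integral>\<^sup>+ y. ennreal (snd y / (1 + norm y ^ (n + m))) \<partial>\<mu>) < \<infinity>"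
    and "\<And>x. x \<in> half_space \<Longrightarrow>
           u x = ereal (poisson_integral n m f x) + green_potential n m \<mu> x"
    and "0 < \<alpha>" and "\<alpha> < 2"
  shows "\<exists>(J :: nat set) (c :: nat \<Rightarrow> (real ^ 'd) \<times> real) (\<rho> :: nat \<Rightarrow> real).
           (\<forall>j\<in>J. c j \<in> half_space \<and> \<rho> j > 0) \<and>
           (\<lambda>j. \<rho> j powr (real n - \<alpha>) / norm (c j) powr (real n - \<alpha>)) summable_on J \<and>
           (let G = (\<Union>j\<in>J. ball (c j) (\<rho> j));
                F = inf at_infinity (principal (half_space - G))
            in eventually (\<lambda>x. \<bar>u x\<bar> \<noteq> \<infinity>) F \<and>
               (\<lambda>x. real_of_ereal (u x))
                 \<in> o[F](\<lambda>x. snd x powr (1 - \<alpha>) * norm x powr (real m + \<alpha>)))"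
proof -
  note n = assms(2) and f = assms(3) and \<mu> = assms(5) and u = assms(7) and \<alpha> = assms(8,9)
  define N1 where "N1 = distr (density lebesgue (\<lambda>y. ennreal (\<bar>f y\<bar> / (1 + norm y ^ (n + m))))) borel
    (\<lambda>y. (y, 0 :: real))"
  define N2 where "N2 = distr (density \<mu> (\<lambda>y. ennreal (snd y / (1 + norm y ^ (n + m))))) borel (\<lambda>y. y)"
  have sets12: "sets N1 = sets borel" "sets N2 = sets borel" by (simp_all add: N1_def N2_def)
  have fin1: "finite_measure N1"
    unfolding N1_def
    by (rule finite_weighted_distr[OF boundary_weight_measurable[OF f] boundary_embedding_measurable assms(4)])
  have fin2: "finite_measure N2"
    unfolding N2_def
    by (rule finite_weighted_distr[OF interior_weight_measurable(2,1)[OF \<mu>] assms(6)])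
  obtain N where N: "finite_measure N" "sets N = sets borel"
    "\<And>A. A \<in> sets borel \<Longrightarrow> emeasure N A = emeasure N1 A + emeasure N2 A"
    using sum_of_finite_measures[OF fin1 fin2 sets12] by metis
  obtain J c \<rho> where J: "\<And>j :: nat. j \<in> J \<Longrightarrow> c j \<in> half_space \<and> 0 < \<rho> j"
    "(\<lambda>j. \<rho> j powr (real n - \<alpha>) / norm (c j) powr (real n - \<alpha>)) summable_on J"
    "\<And>\<epsilon>. 0 < \<epsilon> \<Longrightarrow> \<exists>R. \<forall>x \<in> half_space - (\<Union>j\<in>J. ball (c j) (\<rho> j)). R \<le> norm x \<longrightarrow>
      (\<forall>r. 0 < r \<and> r \<le> norm x / 2 \<longrightarrow> measure N (ball x r) \<le> \<epsilon> * (r / norm x) powr (real n - \<alpha>))"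
    by (rule exceptional_balls[OF N(1,2), of half_space "real n - \<alpha>"]) (assumption | rule that)+
  define S where "S = half_space - (\<Union>j\<in>J. ball (c j) (\<rho> j))"
  have SH: "S \<subseteq> half_space" by (auto simp: S_def)
  have le_N: "measure N1 (ball x r) \<le> measure N (ball x r)" "measure N2 (ball x r) \<le> measure N (ball x r)" for x r
    unfolding measure_def
    using N(3)[of "ball x r"] finite_measure.emeasure_finite[OF N(1), of "ball x r"]
    by (auto intro!: enn2real_mono simp: less_top)
  have ball: "\<exists>R. \<forall>x\<in>S. R \<le> norm x \<longrightarrow>
      (\<forall>r. 0 < r \<and> r \<le> norm x / 2 \<longrightarrow> measure N' (ball x r) \<le> \<epsilon> * (r / norm x) powr (real n - \<alpha>))"
    if "0 < \<epsilon>" "\<And>x r. measure N' (ball x r) \<le> measure N (ball x r)" for \<epsilon> N'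
    using J(3)[OF that(1)] that(2) unfolding S_def[symmetric] by (meson order_trans)
  define T where "T x = snd x powr (1 - \<alpha>) * norm x powr (real m + \<alpha>)" for x :: "'d point"
  obtain C1 where C1: "0 \<le> C1" "\<And>x. 0 < snd x \<Longrightarrow> 2 \<le> norm x \<Longrightarrow>
      ennreal \<bar>poisson_integral n m f x\<bar> \<le> ennreal C1 *
        (\<integral>\<^sup>+y. ennreal (snd x * potential_majorant n m x y) \<partial>N1)"
    unfolding N1_def using n by (elim poisson_integral_bound[OF _ f, rotated]) auto
  obtain C2 where C2: "0 \<le> C2" "\<And>x B. 0 < snd x \<Longrightarrow> 2 \<le> norm x \<Longrightarrow> emeasure N2 {x} = 0 \<Longrightarrow> 0 \<le> B \<Longrightarrow>
      (\<integral>\<^sup>+y. ennreal (snd x * potential_majorant n m x y) \<partial>N2) \<le> ennreal B \<Longrightarrow>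
      \<exists>r. green_potential n m \<mu> x = ereal r \<and> \<bar>r\<bar> \<le> C2 * B"
    unfolding N2_def by (elim green_potential_bound[OF n \<mu>])
  have main: "\<exists>R. \<forall>x\<in>S. R \<le> norm x \<longrightarrow> \<bar>u x\<bar> \<noteq> \<infinity> \<and> \<bar>real_of_ereal (u x)\<bar> \<le> \<delta> * T x"
    if \<delta>: "0 < \<delta>" for \<delta>
  proof -
    \<comment> \<open>the constants of the two potentials add up; the 1 keeps the denominator positive\<close>
    define \<epsilon> where "\<epsilon> = \<delta> / (C1 + C2 + 1)"
    have \<epsilon>: "0 < \<epsilon>" "(C1 + C2) * \<epsilon> \<le> \<delta>" using \<delta> C1(1) C2(1) by (auto simp: \<epsilon>_def divide_simps)
    obtain R1 where R1: "\<And>x. x \<in> S \<Longrightarrow> R1 \<le> norm x \<Longrightarrow>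
        (\<integral>\<^sup>+y. ennreal (snd x * potential_majorant n m x y) \<partial>N1) \<le> ennreal (\<epsilon> * T x)"
      using potential_small[OF fin1 sets12(1) n \<alpha> SH ball[OF _ le_N(1)] \<epsilon>(1)] unfolding T_def by metis
    obtain R2 where R2: "\<And>x. x \<in> S \<Longrightarrow> R2 \<le> norm x \<Longrightarrow> emeasure N2 {x} = 0 \<and>
        (\<integral>\<^sup>+y. ennreal (snd x * potential_majorant n m x y) \<partial>N2) \<le> ennreal (\<epsilon> * T x)"
      using potential_small[OF fin2 sets12(2) n \<alpha> SH ball[OF _ le_N(2)] \<epsilon>(1)] unfolding T_def by metis
    show ?thesis
    proof (intro exI ballI impI)
      fix x assume x: "x \<in> S" "max 2 (max R1 R2) \<le> norm x"
      have xH: "x \<in> half_space" "0 < snd x" using x SH by (auto simp: half_space_def)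
      have T: "0 \<le> T x" by (simp add: T_def)
      have "ennreal \<bar>poisson_integral n m f x\<bar> \<le> ennreal C1 *
          (\<integral>\<^sup>+y. ennreal (snd x * potential_majorant n m x y) \<partial>N1)"
        using x xH by (intro C1) auto
      also have "\<dots> \<le> ennreal C1 * ennreal (\<epsilon> * T x)" using x by (intro mult_left_mono R1) auto
      also have "\<dots> = ennreal (C1 * (\<epsilon> * T x))" using C1(1) by (simp only: ennreal_mult')
      finally have v: "\<bar>poisson_integral n m f x\<bar> \<le> C1 * (\<epsilon> * T x)"
        using C1(1) \<epsilon>(1) T by (subst (asm) ennreal_le_iff) auto
      have "\<exists>r. green_potential n m \<mu> x = ereal r \<and> \<bar>r\<bar> \<le> C2 * (\<epsilon> * T x)"
        using R2[of x] x xH \<epsilon>(1) T by (intro C2) auto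
      then obtain r where r: "green_potential n m \<mu> x = ereal r" "\<bar>r\<bar> \<le> C2 * (\<epsilon> * T x)" by blast
      have ux: "u x = ereal (poisson_integral n m f x + r)" using u[OF xH(1)] r(1) by simp
      have "\<bar>poisson_integral n m f x + r\<bar> \<le> (C1 + C2) * \<epsilon> * T x"
        using v r(2) by (simp add: distrib_right mult.assoc abs_le_iff)
      also have "\<dots> \<le> \<delta> * T x" using \<epsilon>(2) T by (rule mult_right_mono)
      finally show "\<bar>u x\<bar> \<noteq> \<infinity> \<and> \<bar>real_of_ereal (u x)\<bar> \<le> \<delta> * T x" by (simp add: ux)
    qed
  qed
  define F where "F = inf at_infinity (principal S)"
  have ev: "eventually (\<lambda>x. \<bar>u x\<bar> \<noteq> \<infinity> \<and> \<bar>real_of_ereal (u x)\<bar> \<le> \<delta> * T x) F"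
    if \<delta>: "0 < \<delta>" for \<delta>
  proof -
    obtain R where R: "\<forall>x\<in>S. R \<le> norm x \<longrightarrow> \<bar>u x\<bar> \<noteq> \<infinity> \<and> \<bar>real_of_ereal (u x)\<bar> \<le> \<delta> * T x"
      using main[OF \<delta>] by (rule exE)
    show ?thesis
      unfolding F_def eventually_inf_principal eventually_at_infinity
      by (intro exI[of _ R] allI impI) (rule R[rule_format])
  qed
  have "eventually (\<lambda>x. \<bar>u x\<bar> \<noteq> \<infinity>) F"
    using ev[OF zero_less_one] by (rule eventually_mono) (rule conjunct1)
  moreover have "(\<lambda>x. real_of_ereal (u x)) \<in> o[F](T)"
  proof (rule landau_o.smallI)
    fix \<delta> :: real assume "0 < \<delta>"
    from ev[OF this] show "eventually (\<lambda>x. norm (real_of_ereal (u x)) \<le> \<delta> * norm (T x)) F"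
      by eventually_elim (simp add: T_def)
  qed
  moreover have "\<forall>j\<in>J. c j \<in> half_space \<and> 0 < \<rho> j" using J(1) by blast
  ultimately show ?thesis
    using J(2) unfolding F_def S_def T_def[abs_def] Let_def
    by (intro exI[of _ J] exI[of _ c] exI[of _ \<rho>] conjI)
qed

end
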